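(* Let $L=(L,d,[\cdot,\cdot])$ be a differential graded Lie algebra with $d$ of degree $+1$, and let $\eta:L\to L$ be a map of degree $-1$ with $d\eta d=d$, $\eta^2=0$ and $\eta d\eta=\eta$. Put $[d,\eta]=d\eta+\eta d$, $H:=\ker[d,\eta]$ and $g:=\eta\circ[\cdot,\cdot]$. Then the following graded anti-symmetric maps $\mu_n:H^{\otimes n}\to H$ of degree $2-n$ define the structure of an $L_\infty$-algebra on $H$: $$\mu_1:=0,\qquad \mu_2:=(1-d\eta)[\cdot,\cdot],$$ $$\mu_n:=\Bigl(\frac{-1}{2}\Bigr)^{n-1}\sum_{\phi\in\mathrm{Ot}(n)}e(\phi)\,\phi\bigl((1-[d,\eta])[\cdot,\cdot],g,\dots,g\bigr)\circ\alpha_n\qquad(n\ge2).$$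
   Context: Conventions. $k$ is a commutative ring containing $\mathbb{Q}$; modules are $\mathbb{Z}$-graded $k$-modules, maps are $k$-linear, and the Koszul sign rule $(f\otimes g)(a\otimes b)=(-1)^{|g||a|}f(a)\otimes g(b)$ is used. For $\sigma\in\Sigma_n$ and homogeneous $a_1,\dots,a_n$, the sign $\chi(\sigma)=\chi(\sigma,a_1,\dots,a_n)$ is defined by $a_{\sigma(1)}\wedge\cdots\wedge a_{\sigma(n)}=\chi(\sigma)\,a_1\wedge\cdots\wedge a_n$ in the graded exterior algebra ($a\wedge b=-(-1)^{|a||b|}b\wedge a$). The map $\alpha_n:L^{\otimes n}\to L^{\otimes n}$ is $\alpha_n(a_1\otimes\cdots\otimes a_n)=\sum_{\sigma\in\Sigma_n}\chi(\sigma)\,a_{\sigma(1)}\otimes\cdots\otimes a_{\sigma(n)}$. $\mathrm{Sh}(k,n)$ is the set of $\sigma\in\Sigma_n$ with $\sigma(1)<\dots<\sigma(k)$ and $\sigma(k+1)<\dots<\sigma(n)$. $L_\infty$-algebras. An $L_\infty$-algebra (with $\mu_0=0$) is a graded module $H$ with graded anti-symmetric maps $\mu_n:H^{\otimes n}\to H$ of degree $2-n$, $n\ge1$, such that for all $n\ge 1$ and homogeneous $a_1,\dots,a_n$ $$\sum_{k+l=n+1}\ \sum_{\sigma\in\mathrm{Sh}(k,n)}(-1)^{k(l-1)}\chi(\sigma)\,\mu_l\bigl(\mu_k(a_{\sigma(1)},\dots,a_{\sigma(k)}),a_{\sigma(k+1)},\dots,a_{\sigma(n)}\bigr)=0 .$$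 Trees. $\mathrm{Ot}(n)$ is the set of (equivalence classes of) oriented trees with $n$ leaves, i.e. planar rooted binary trees with $n$ leaves and $n-1$ ramifications (internal vertices), each ramification having exactly one left and one right child (each of which is a ramification or a leaf); the leaves are numbered $1,\dots,n$ from left to right, and the tree $\tau$ with one leaf has no ramification. For a leaf $i$ of $\phi$, $w_\phi(i)$ is the number of left steps on the path from the root to leaf $i$ (equivalently, the number of ramifications preceding leaf $i$ in the depth-first left-to-right order in which a vertex precedes its descendants, minus $i-1$). For $n\ge 2$, $e(\phi):=(-1)^{w_\phi(1)+\cdots+w_\phi(n)}$, and $e(\tau):=1$. Given a family $B=(b_K)$ of bilinear maps $b_K:L\otimes L\to L$ indexed by the ramifications $K$ of $\phi$, the multilinear map $\phi(B):L^{\otimes n}\to L$ is defined recursively: $\tau(\emptyset)=\mathrm{Id}$, and if $\phi$ has root $K_0$ with left subtree $\phi_1$ and right subtree $\phi_2$, then $\phi(B)=b_{K_0}\circ(\phi_1(B_1)\otimes\phi_2(B_2))$, where $B_1,B_2$ are the restrictions of $B$ to the ramifications of $\phi_1,\phi_2$. The notation $\phi(b_0,g,\dots,g)$ means that the root carries $b_0$ and every other ramification carries $g$. The operator $[d,\eta]$ is a projection, so $1-[d,\eta]$ is a projection of $L$ onto $H$, and $H$ is isomorphic as a module to the homology of $(L,d)$. *)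

theory Defs
  imports Complex_Main "HOL-Library.Tree" "HOL-Combinatorics.Permutations"
begin

definition rat_embedding :: "(rat \<Rightarrow> 'k::comm_ring_1) \<Rightarrow> bool" where
  "rat_embedding \<iota> \<longleftrightarrow> inj \<iota> \<and> \<iota> 1 = 1 \<and>
     (\<forall>p q. \<iota> (p + q) = \<iota> p + \<iota> q) \<and> (\<forall>p q. \<iota> (p * q) = \<iota> p * \<iota> q)"

text \<open>The sign \<open>(-1)^m\<close> for an integer exponent.\<close>

definition ksgn :: "int \<Rightarrow> 'k::comm_ring_1" where
  "ksgn m = (if even m then 1 else - 1)"


section \<open>Graded modules\<close>

text \<open>
  A graded module is the internal direct sum \<open>V\<close> of a family of submodules \<open>G i\<close>, \<open>i :: int\<close>.
  Infinitely many degrees may be nonzero, but every element has finitely many components.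
\<close>

definition homogeneous_decomposition ::
  "(int \<Rightarrow> 'a::ab_group_add set) \<Rightarrow> 'a \<Rightarrow> (int \<Rightarrow> 'a) \<Rightarrow> bool" where
  "homogeneous_decomposition G x c \<longleftrightarrow>
     (\<forall>i. c i \<in> G i) \<and> finite {i. c i \<noteq> 0} \<and> x = (\<Sum>i | c i \<noteq> 0. c i)"

definition hcomp :: "(int \<Rightarrow> 'a::ab_group_add set) \<Rightarrow> 'a \<Rightarrow> int \<Rightarrow> 'a" where
  "hcomp G x = (THE c. homogeneous_decomposition G x c)"

locale graded_module = module scale
  for scale :: "'k::comm_ring_1 \<Rightarrow> 'a::ab_group_add \<Rightarrow> 'a" +
  fixes V :: "'a set" and G :: "int \<Rightarrow> 'a set"
  assumes subspace_carrier: "subspace V"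
    and subspace_degree: "\<And>i. subspace (G i)"
    and degree_subset: "\<And>i. G i \<subseteq> V"
    and direct_sum: "\<And>x. x \<in> V \<Longrightarrow> \<exists>!c. homogeneous_decomposition G x c"

text \<open>
  Linear maps out of an \<open>n\<close>-th tensor power are rendered as multilinear functions of a list of
  length \<open>n\<close>; the list \<open>[a\<^sub>1, \<dots>, a\<^sub>n]\<close> stands for \<open>a\<^sub>1 \<otimes> \<dots> \<otimes> a\<^sub>n\<close>.
\<close>

definition multilinear_on ::
  "('k::comm_ring_1 \<Rightarrow> 'a::ab_group_add \<Rightarrow> 'a) \<Rightarrow> 'a set \<Rightarrow> nat \<Rightarrow> ('a list \<Rightarrow> 'a) \<Rightarrow> bool" where
  "multilinear_on scale V n f \<longleftrightarrow>
     (\<forall>xs i x y c. length xs = n \<and> set xs \<subseteq> V \<and> i < n \<and> x \<in> V \<and> y \<in> V \<longrightarrow>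
        f (xs[i := x + y]) = f (xs[i := x]) + f (xs[i := y]) \<and>
        f (xs[i := scale c x]) = scale c (f (xs[i := x])))"

definition homogeneous_list :: "(int \<Rightarrow> 'a set) \<Rightarrow> int list \<Rightarrow> 'a list \<Rightarrow> bool" where
  "homogeneous_list G ds xs \<longleftrightarrow> list_all2 (\<lambda>i x. x \<in> G i) ds xs"

text \<open>
  Koszul signs depend on the degrees of the arguments.  A formula for homogeneous arguments is
  therefore a function \<open>F ds xs\<close> of the degrees and the elements; it is extended to arbitrary
  elements by expanding each argument into its homogeneous components.
\<close>

definition multilinear_extension ::
  "(int \<Rightarrow> 'a::ab_group_add set) \<Rightarrow> (int list \<Rightarrow> 'a list \<Rightarrow> 'a) \<Rightarrow> 'a list \<Rightarrow> 'a" where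
  "multilinear_extension G F xs =
     (\<Sum>ds | length ds = length xs \<and> (\<forall>j < length xs. hcomp G (xs ! j) (ds ! j) \<noteq> 0).
        F ds (map2 (hcomp G) xs ds))"


section \<open>The sign \<open>\<chi>\<close>, anti-symmetrization, shuffles\<close>

text \<open>
  Permutations act on the 0-based positions \<open>{..<n}\<close>, and \<open>permute_list \<sigma> [a\<^sub>1, \<dots>, a\<^sub>n]\<close> is
  \<open>[a\<^bsub>\<sigma>(1)\<^esub>, \<dots>, a\<^bsub>\<sigma>(n)\<^esub>]\<close>.  In \<open>chi \<sigma> ds\<close> the list \<open>ds\<close> holds the degrees of
  \<open>a\<^sub>1, \<dots>, a\<^sub>n\<close>.  Sorting \<open>a\<^bsub>\<sigma>(1)\<^esub> \<and> \<dots> \<and> a\<^bsub>\<sigma>(n)\<^esub>\<close> with the rule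
  \<open>a \<and> b = - (-1)^(|a||b|) b \<and> a\<close> yields one factor for each inversion of \<open>\<sigma>\<close>.  The lemmas
  \<open>chi_id\<close> and \<open>chi_adjacent_swap\<close> below show that this is the sign determined by that rule.
\<close>

definition inversions :: "nat \<Rightarrow> (nat \<Rightarrow> nat) \<Rightarrow> (nat \<times> nat) set" where
  "inversions n \<sigma> = {(i, j). i < j \<and> j < n \<and> \<sigma> j < \<sigma> i}"

definition chi :: "(nat \<Rightarrow> nat) \<Rightarrow> int list \<Rightarrow> 'k::comm_ring_1" where
  "chi \<sigma> ds = (\<Prod>(i, j) \<in> inversions (length ds) \<sigma>. - ksgn (ds ! \<sigma> i * ds ! \<sigma> j))"

text \<open>\<open>T \<circ> \<alpha>\<^sub>n\<close> on homogeneous arguments.\<close>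

definition comp_alpha ::
  "('k::comm_ring_1 \<Rightarrow> 'a::ab_group_add \<Rightarrow> 'a) \<Rightarrow> (int list \<Rightarrow> 'a list \<Rightarrow> 'a)
     \<Rightarrow> int list \<Rightarrow> 'a list \<Rightarrow> 'a" where
  "comp_alpha scale T ds xs =
     (\<Sum>\<sigma> | \<sigma> permutes {..<length xs}.
        scale (chi \<sigma> ds) (T (permute_list \<sigma> ds) (permute_list \<sigma> xs)))"

definition Sh :: "nat \<Rightarrow> nat \<Rightarrow> (nat \<Rightarrow> nat) set" where
  "Sh k n = {\<sigma>. \<sigma> permutes {..<n} \<and> strict_mono_on {..<k} \<sigma> \<and> strict_mono_on {k..<n} \<sigma>}"


section \<open>Differential graded Lie algebras and \<open>L\<^sub>\<infinity>\<close>-algebras\<close>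

locale dg_lie_algebra = graded_module scale UNIV L
  for scale :: "'k::comm_ring_1 \<Rightarrow> 'a::ab_group_add \<Rightarrow> 'a" and L :: "int \<Rightarrow> 'a set" +
  fixes d :: "'a \<Rightarrow> 'a" and bracket :: "'a \<Rightarrow> 'a \<Rightarrow> 'a"
  assumes d_linear: "module_hom scale scale d"
    and d_degree: "\<And>i x. x \<in> L i \<Longrightarrow> d x \<in> L (i + 1)"
    and d_squared: "\<And>x. d (d x) = 0"
    and bracket_linear_left: "\<And>y. module_hom scale scale (\<lambda>x. bracket x y)"
    and bracket_linear_right: "\<And>x. module_hom scale scale (bracket x)"
    and bracket_degree: "\<And>i j x y. x \<in> L i \<Longrightarrow> y \<in> L j \<Longrightarrow> bracket x y \<in> L (i + j)"
    and bracket_antisym: "\<And>i j x y. x \<in> L i \<Longrightarrow> y \<in> L j \<Longrightarrow>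
          bracket x y = scale (- ksgn (i * j)) (bracket y x)"
    and jacobi: "\<And>i j k x y z. x \<in> L i \<Longrightarrow> y \<in> L j \<Longrightarrow> z \<in> L k \<Longrightarrow>
          bracket x (bracket y z)
            = bracket (bracket x y) z + scale (ksgn (i * j)) (bracket y (bracket x z))"
    and leibniz: "\<And>i j x y. x \<in> L i \<Longrightarrow> y \<in> L j \<Longrightarrow>
          d (bracket x y) = bracket (d x) y + scale (ksgn i) (bracket x (d y))"

text \<open>
  \<open>mu n\<close> is only constrained on lists of length \<open>n \<ge> 1\<close> with entries in \<open>H\<close>.
\<close>

locale L_infinity_algebra = graded_module scale H G
  for scale :: "'k::comm_ring_1 \<Rightarrow> 'a::ab_group_add \<Rightarrow> 'a"
    and H :: "'a set" and G :: "int \<Rightarrow> 'a set" +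
  fixes mu :: "nat \<Rightarrow> 'a list \<Rightarrow> 'a"
  assumes mu_closed: "\<And>n xs. 1 \<le> n \<Longrightarrow> length xs = n \<Longrightarrow> set xs \<subseteq> H \<Longrightarrow> mu n xs \<in> H"
    and mu_multilinear: "\<And>n. 1 \<le> n \<Longrightarrow> multilinear_on scale H n (mu n)"
    and mu_degree: "\<And>n ds xs. 1 \<le> n \<Longrightarrow> length xs = n \<Longrightarrow> homogeneous_list G ds xs \<Longrightarrow>
          mu n xs \<in> G (sum_list ds + 2 - int n)"
    and mu_antisym: "\<And>n ds xs \<sigma>. 1 \<le> n \<Longrightarrow> length xs = n \<Longrightarrow> homogeneous_list G ds xs \<Longrightarrow>
          \<sigma> permutes {..<n} \<Longrightarrow> mu n (permute_list \<sigma> xs) = scale (chi \<sigma> ds) (mu n xs)"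
    and mu_identity: "\<And>n ds xs. 1 \<le> n \<Longrightarrow> length xs = n \<Longrightarrow> homogeneous_list G ds xs \<Longrightarrow>
          (\<Sum>(k, l) | 1 \<le> k \<and> 1 \<le> l \<and> k + l = n + 1. \<Sum>\<sigma>\<in>Sh k n.
             scale ((- 1) ^ (k * (l - 1)) * chi \<sigma> ds)
               (mu l (mu k (take k (permute_list \<sigma> xs)) # drop k (permute_list \<sigma> xs)))) = 0"


section \<open>Oriented trees\<close>

text \<open>
  An oriented tree is a binary tree of the library without labels: inner nodes are the
  ramifications, and \<open>size1\<close> counts the leaves.
\<close>

definition Ot :: "nat \<Rightarrow> unit tree set" where
  "Ot n = {\<phi>. size1 \<phi> = n}"

text \<open>The list \<open>[w\<^sub>\<phi>(1), \<dots>, w\<^sub>\<phi>(n)]\<close>.\<close>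

fun left_steps :: "'b tree \<Rightarrow> nat list" where
  "left_steps Leaf = [0]"
| "left_steps (Node l _ r) = map Suc (left_steps l) @ left_steps r"

definition tree_sign :: "'b tree \<Rightarrow> 'k::comm_ring_1" where
  "tree_sign \<phi> = (- 1) ^ sum_list (left_steps \<phi>)"

text \<open>
  A family \<open>B\<close> of homogeneous bilinear maps indexed by the ramifications of \<open>\<phi>\<close> is a tree of
  shape \<open>\<phi>\<close> in which each node is labelled by the degree of its map and the map.
\<close>

type_synonym 'a decorated_tree = "(int \<times> ('a \<Rightarrow> 'a \<Rightarrow> 'a)) tree"

fun tree_degree :: "'a decorated_tree \<Rightarrow> int" where
  "tree_degree Leaf = 0"
| "tree_degree (Node l (p, b) r) = p + tree_degree l + tree_degree r"

text \<open>
  \<open>\<phi>(B)\<close> on homogeneous arguments \<open>xs\<close> of degrees \<open>ds\<close>.  The sign is the one in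
  \<open>(\<phi>\<^sub>1(B\<^sub>1) \<otimes> \<phi>\<^sub>2(B\<^sub>2)) (u \<otimes> v) = (-1)^(|\<phi>\<^sub>2(B\<^sub>2)| |u|) \<phi>\<^sub>1(B\<^sub>1)(u) \<otimes> \<phi>\<^sub>2(B\<^sub>2)(v)\<close>.
\<close>

fun tree_map_eval ::
  "('k::comm_ring_1 \<Rightarrow> 'a::ab_group_add \<Rightarrow> 'a) \<Rightarrow> 'a decorated_tree \<Rightarrow> int list \<Rightarrow> 'a list \<Rightarrow> 'a"
where
  "tree_map_eval scale Leaf ds xs = hd xs"
| "tree_map_eval scale (Node l (p, b) r) ds xs =
     (let m = size1 l in
      scale (ksgn (tree_degree r * sum_list (take m ds)))
        (b (tree_map_eval scale l (take m ds) (take m xs))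
           (tree_map_eval scale r (drop m ds) (drop m xs))))"

text \<open>The decoration of \<open>\<phi>(b\<^sub>0, g, \<dots>, g)\<close>; the arguments carry the degrees of the maps.\<close>

fun decorate_root ::
  "int \<times> ('a \<Rightarrow> 'a \<Rightarrow> 'a) \<Rightarrow> int \<times> ('a \<Rightarrow> 'a \<Rightarrow> 'a) \<Rightarrow> unit tree \<Rightarrow> 'a decorated_tree" where
  "decorate_root b0 g Leaf = Leaf"
| "decorate_root b0 g (Node l _ r) = Node (map_tree (\<lambda>_. g) l) b0 (map_tree (\<lambda>_. g) r)"


section \<open>The transferred structure\<close>

definition comm_op :: "('a::ab_group_add \<Rightarrow> 'a) \<Rightarrow> ('a \<Rightarrow> 'a) \<Rightarrow> 'a \<Rightarrow> 'a" where
  "comm_op d \<eta> x = d (\<eta> x) + \<eta> (d x)"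

definition ker_comm_op :: "('a::ab_group_add \<Rightarrow> 'a) \<Rightarrow> ('a \<Rightarrow> 'a) \<Rightarrow> 'a set" where
  "ker_comm_op d \<eta> = {x. comm_op d \<eta> x = 0}"

definition tree_formula ::
  "('k::comm_ring_1 \<Rightarrow> 'a::ab_group_add \<Rightarrow> 'a) \<Rightarrow> (rat \<Rightarrow> 'k) \<Rightarrow> ('a \<Rightarrow> 'a) \<Rightarrow> ('a \<Rightarrow> 'a \<Rightarrow> 'a)
     \<Rightarrow> ('a \<Rightarrow> 'a) \<Rightarrow> nat \<Rightarrow> int list \<Rightarrow> 'a list \<Rightarrow> 'a" where
  "tree_formula scale \<iota> d bracket \<eta> n ds xs =
     (let b0 = (\<lambda>x y. bracket x y - comm_op d \<eta> (bracket x y));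
          g = (\<lambda>x y. \<eta> (bracket x y))
      in scale (\<iota> ((- 1 / 2) ^ (n - 1)))
           (\<Sum>\<phi>\<in>Ot n. scale (tree_sign \<phi>)
              (comp_alpha scale (tree_map_eval scale (decorate_root (0, b0) (- 1, g) \<phi>)) ds xs)))"

definition transferred_mu ::
  "('k::comm_ring_1 \<Rightarrow> 'a::ab_group_add \<Rightarrow> 'a) \<Rightarrow> (rat \<Rightarrow> 'k) \<Rightarrow> (int \<Rightarrow> 'a set) \<Rightarrow> ('a \<Rightarrow> 'a)
     \<Rightarrow> ('a \<Rightarrow> 'a \<Rightarrow> 'a) \<Rightarrow> ('a \<Rightarrow> 'a) \<Rightarrow> nat \<Rightarrow> 'a list \<Rightarrow> 'a" where
  "transferred_mu scale \<iota> L d bracket \<eta> n xs =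
     (if n \<le> 1 then 0
      else multilinear_extension L (tree_formula scale \<iota> d bracket \<eta> n) xs)"


section \<open>Sanity checks\<close>

lemma finite_Ot: "finite (Ot n)"
proof (induction n rule: less_induct)
  case (less n)
  have "Ot n \<subseteq> {Leaf} \<union> (\<lambda>(l, r). Node l () r) ` ((\<Union>m<n. Ot m) \<times> (\<Union>m<n. Ot m))"
  proof
    fix t assume t: "t \<in> Ot n"
    show "t \<in> {Leaf} \<union> (\<lambda>(l, r). Node l () r) ` ((\<Union>m<n. Ot m) \<times> (\<Union>m<n. Ot m))"
    proof (cases t)
      case (Node l u r)
      then have "size1 l < n" "size1 r < n"
        using t by (auto simp: Ot_def size1_size)
      then have "(l, r) \<in> (\<Union>m<n. Ot m) \<times> (\<Union>m<n. Ot m)"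
        by (auto simp: Ot_def)
      then show ?thesis using Node by force
    qed simp
  qed
  moreover have "finite (\<Union>m<n. Ot m)" using less by auto
  ultimately show ?case by (meson finite.emptyI finite.insertI finite_SigmaI finite_UnI
        finite_imageI finite_subset)
qed

lemma ksgn_mult_self [simp]: "ksgn m * ksgn m = (1 :: 'k::comm_ring_1)"
  by (simp add: ksgn_def)

lemma finite_inversions [simp]: "finite (inversions n \<sigma>)"
  by (rule finite_subset[of _ "{..<n} \<times> {..<n}"]) (auto simp: inversions_def)

lemma chi_id: "chi id ds = (1 :: 'k::comm_ring_1)"
proof -
  have "inversions (length ds) id = {}" by (auto simp: inversions_def)
  then show ?thesis by (simp add: chi_def)
qed

lemma chi_adjacent_swap:
  assumes "\<sigma> permutes {..<length ds}" and "Suc p < length ds"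
  shows "chi (\<sigma> \<circ> transpose p (Suc p)) ds
       = - ksgn (ds ! \<sigma> p * ds ! \<sigma> (Suc p)) * (chi \<sigma> ds :: 'k::comm_ring_1)"
proof -
  let ?n = "length ds" and ?t = "transpose p (Suc p)"
  have asc: "chi (\<sigma> \<circ> ?t) ds = - ksgn (ds ! \<sigma> p * ds ! \<sigma> (Suc p)) * (chi \<sigma> ds :: 'k)"
    if lt: "\<sigma> p < \<sigma> (Suc p)" for \<sigma> :: "nat \<Rightarrow> nat"
  proof -
    define f where "f = (\<lambda>(i, j). (?t i, ?t j))"
    have move: "?t i < ?t j" if "i < j" "(i, j) \<noteq> (p, Suc p)" for i j
      using that by (cases "i = p"; cases "i = Suc p"; cases "j = p"; cases "j = Suc p") auto
    have bound: "?t j < ?n" if "j < ?n" for j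
      using that assms(2) by (cases "j = p"; cases "j = Suc p") auto
    have sub1: "f x \<in> inversions ?n (\<sigma> \<circ> ?t) - {(p, Suc p)}"
      if x: "x \<in> inversions ?n \<sigma>" for x
    proof -
      obtain i j where ij: "x = (i, j)" "i < j" "j < ?n" "\<sigma> j < \<sigma> i"
        using x by (auto simp: inversions_def)
      have "(i, j) \<noteq> (p, Suc p)" using ij(4) lt by auto
      moreover have "(?t i, ?t j) \<noteq> (p, Suc p)"
      proof
        assume "(?t i, ?t j) = (p, Suc p)"
        then have "?t (?t i) = Suc p" "?t (?t j) = p" by simp_all
        then show False using ij(2) by simp
      qed
      ultimately show ?thesis using ij move bound by (simp add: f_def inversions_def)
    qed
    have sub2: "f x \<in> inversions ?n \<sigma>" if x: "x \<in> inversions ?n (\<sigma> \<circ> ?t) - {(p, Suc p)}" for x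
    proof -
      obtain i j where "x = (i, j)" "i < j" "j < ?n" "\<sigma> (?t j) < \<sigma> (?t i)" "(i, j) \<noteq> (p, Suc p)"
        using x by (auto simp: inversions_def)
      then show ?thesis using move bound by (simp add: f_def inversions_def)
    qed
    have ff: "f (f x) = x" for x by (cases x) (simp add: f_def)
    have eq: "inversions ?n (\<sigma> \<circ> ?t) = insert (p, Suc p) (f ` inversions ?n \<sigma>)"
    proof -
      have "(p, Suc p) \<in> inversions ?n (\<sigma> \<circ> ?t)"
        using lt assms(2) by (simp add: inversions_def)
      moreover have "f ` inversions ?n \<sigma> = inversions ?n (\<sigma> \<circ> ?t) - {(p, Suc p)}"
      proof
        show "f ` inversions ?n \<sigma> \<subseteq> inversions ?n (\<sigma> \<circ> ?t) - {(p, Suc p)}"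
          by (rule image_subsetI) (rule sub1)
        show "inversions ?n (\<sigma> \<circ> ?t) - {(p, Suc p)} \<subseteq> f ` inversions ?n \<sigma>"
        proof
          fix x assume "x \<in> inversions ?n (\<sigma> \<circ> ?t) - {(p, Suc p)}"
          then show "x \<in> f ` inversions ?n \<sigma>"
            by (metis sub2 ff image_eqI)
        qed
      qed
      ultimately show ?thesis by blast
    qed
    have notin: "(p, Suc p) \<notin> f ` inversions ?n \<sigma>"
    proof
      assume "(p, Suc p) \<in> f ` inversions ?n \<sigma>"
      then obtain x where "(p, Suc p) = f x" "x \<in> inversions ?n \<sigma>" by (rule imageE)
      with sub1[OF this(2)] show False by simp
    qed
    have inj: "inj_on f (inversions ?n \<sigma>)" by (rule inj_on_inverseI[of _ f]) (rule ff)
    let ?h = "\<lambda>(i, j). - ksgn (ds ! (\<sigma> \<circ> ?t) i * ds ! (\<sigma> \<circ> ?t) j) :: 'k"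
    have "chi (\<sigma> \<circ> ?t) ds = ?h (p, Suc p) * prod ?h (f ` inversions ?n \<sigma>)"
      unfolding chi_def eq using notin by (subst prod.insert) simp_all
    also have "prod ?h (f ` inversions ?n \<sigma>) = chi \<sigma> ds"
      unfolding prod.reindex[OF inj] chi_def by (rule prod.cong) (auto simp: f_def)
    also have "?h (p, Suc p) = - ksgn (ds ! \<sigma> p * ds ! \<sigma> (Suc p))"
      by (simp add: mult.commute)
    finally show ?thesis .
  qed
  have "\<sigma> p \<noteq> \<sigma> (Suc p)"
    using permutes_inj[OF assms(1)] by (simp add: inj_eq)
  then consider "\<sigma> p < \<sigma> (Suc p)" | "\<sigma> (Suc p) < \<sigma> p" by linarith
  then show ?thesis
  proof cases
    case 1
    then show ?thesis by (rule asc)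
  next
    case 2
    let ?c = "- ksgn (ds ! \<sigma> p * ds ! \<sigma> (Suc p)) :: 'k"
    have "chi ((\<sigma> \<circ> ?t) \<circ> ?t) ds
        = - ksgn (ds ! (\<sigma> \<circ> ?t) p * ds ! (\<sigma> \<circ> ?t) (Suc p)) * (chi (\<sigma> \<circ> ?t) ds :: 'k)"
      by (rule asc) (simp add: 2)
    also have "- ksgn (ds ! (\<sigma> \<circ> ?t) p * ds ! (\<sigma> \<circ> ?t) (Suc p)) = ?c"
      by (simp add: mult.commute)
    finally have "chi ((\<sigma> \<circ> ?t) \<circ> ?t) ds = ?c * chi (\<sigma> \<circ> ?t) ds" .
    moreover have "(\<sigma> \<circ> ?t) \<circ> ?t = \<sigma>" by (simp add: comp_assoc)
    ultimately have "?c * chi \<sigma> ds = ?c * (?c * chi (\<sigma> \<circ> ?t) ds)" by (simp only:)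
    also have "\<dots> = chi (\<sigma> \<circ> ?t) ds"
      by (simp only: mult.assoc[symmetric] minus_mult_minus ksgn_mult_self mult_1_left)
    finally show ?thesis by (rule sym)
  qed
qed

end

theory Submission
  imports Defs "HOL-Combinatorics.Multiset_Permutations"
begin

text \<open>
  Why the transferred operations satisfy the \<open>L\<^sub>\<infinity>\<close> identities: up to sign they are the Taylor
  coefficients of the projected curvature of a family of elements of degree \<open>1\<close>, and the identities
  are the projection of its Bianchi identity.

  Attach to each argument \<open>a i\<close> a formal parameter whose degree is opposite to the shifted degree
  \<open>p i = |a i| - 1\<close>.  Then \<open>x = \<Sum> a i \<cdot> t i\<close> has total degree \<open>1\<close>.  Only the coefficients of
  squarefree monomials matter, so an element of the extended dg Lie algebra is a function of the
  finite set \<open>S\<close> of indices that occur in the monomial.  The bracket of two such functions is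
  \<open>convolve\<close>, a sum over all ways to cut \<open>S\<close> in two with the Koszul sign of the shifted degrees.
  The Leibniz rule and the Jacobi identity for elements of degree \<open>1\<close> become \<open>d_convolve\<close> and
  \<open>convolve_jacobi\<close>.

  Summing over all trees, with \<open>g\<close> at every ramification, gives the solution \<open>\<Phi>\<close> (\<open>Phi\<close>) of
  \<open>\<Phi> = x - 1/2 \<eta>[\<Phi>, \<Phi>]\<close>: a tree whose leaves are labelled by \<open>S\<close> is cut at its root into two trees
  labelled by complementary subsets (\<open>tree_sum_convolve\<close>).  Replacing the root by
  \<open>(1 - [d, \<eta>])[\<cdot>, \<cdot>]\<close> gives \<open>M = - 1/2 (1 - [d, \<eta>])[\<Phi>, \<Phi>]\<close> (\<open>Mu\<close>).  Put \<open>F = d\<Phi> + 1/2 [\<Phi>, \<Phi>]\<close>.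
  Jacobi and Leibniz give \<open>[F, \<Phi>] = 1/2 d[\<Phi>, \<Phi>]\<close>, and together with \<open>dx = 0\<close> this yields
  \<open>F = - M + \<eta>[F, \<Phi>]\<close>.  On the other hand the derivative \<open>\<Psi>\<close> of \<open>\<Phi>\<close> in the direction \<open>M\<close>
  satisfies \<open>\<Psi> = M + \<eta>[\<Psi>, \<Phi>]\<close>.  As \<open>\<Phi>\<close> has no constant term, such an equation determines its
  solution by recursion on the size of the index set, so \<open>\<Psi> = - F\<close> (\<open>dPhi_Mu_eq_curvature\<close>).
  Hence the derivative of \<open>M\<close> in the direction \<open>M\<close> is
  \<open>(1 - [d, \<eta>])[\<Psi>, \<Phi>] = - 1/2 (1 - [d, \<eta>]) d[\<Phi>, \<Phi>] = 0\<close>.  This is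
  \<open>Mu_identity\<close>, the generalized Jacobi identity in shifted degrees.

  What remains is to pass from shifted to unshifted degrees.  The sign \<open>(-1) ^ decalage dg S\<close>
  turns the signs \<open>e(\<phi>)\<close> and \<open>\<chi>\<close> and the Koszul signs of tree maps into the shifted ones, tree by
  tree (\<open>tree_term_eval\<close>); shuffles are subsets (\<open>sum_shuffles\<close>), which rewrites the
  \<open>L\<^sub>\<infinity>\<close> identity as \<open>Mu_identity\<close> (\<open>mu_composite\<close>).  Antisymmetry holds because \<open>\<chi>\<close> is a cocycle
  (\<open>chi_comp\<close>).
\<close>


section \<open>Signs\<close>

text \<open>
  The sign acts on an arbitrary abelian group, which keeps the scalars out of the bookkeeping:
  two signed terms are compared by the parity of the difference of their exponents (\<open>sg_cong\<close>).
\<close>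

definition sg :: "int \<Rightarrow> 'a::ab_group_add \<Rightarrow> 'a" where
  "sg m x = (if even m then x else - x)"

lemma sg_0 [simp]: "sg 0 x = x" and sg_zero [simp]: "sg m 0 = 0"
  by (simp_all add: sg_def)

lemma sg_sg [simp]: "sg m (sg n x) = sg (m + n) x"
  by (simp add: sg_def)

lemma sg_add: "sg m (x + y) = sg m x + sg m y"
  by (simp add: sg_def)

lemma sg_minus: "sg m (- x) = - sg m x"
  by (simp add: sg_def)

lemma sg_sum: "sg m (sum f A) = (\<Sum>x\<in>A. sg m (f x))"
  by (simp add: sg_def sum_negf)

lemma sg_cong: "even (m - n) \<Longrightarrow> sg m x = sg n x"
  by (auto simp: sg_def)

lemma sg_one_plus: "sg (1 + m) x = - sg m x"
  by (simp add: sg_def)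

lemma ksgn_add: "ksgn (m + n) = ksgn m * ksgn n"
  by (simp add: ksgn_def)

lemma ksgn_one_plus: "ksgn (1 + m) = - ksgn m"
  by (simp add: ksgn_def)

lemma ksgn_0 [simp]: "ksgn 0 = 1"
  by (simp add: ksgn_def)

lemma minus_one_power_ksgn: "(- 1) ^ n = (ksgn (int n) :: 'k::comm_ring_1)"
  by (simp add: ksgn_def uminus_power_if)


section \<open>Sums over ordered partitions of a finite set\<close>

lemma sum_Pow_complement:
  assumes "finite S"
  shows "(\<Sum>A\<in>Pow S. f A (S - A)) = (\<Sum>A\<in>Pow S. f (S - A) A)"
  by (rule sum.reindex_bij_witness[of _ "\<lambda>A. S - A" "\<lambda>A. S - A"])
     (auto simp: double_diff)

lemma sum_Pow_insert:
  assumes "finite B" "x \<notin> B"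
  shows "(\<Sum>A\<in>Pow (insert x B). f A) = (\<Sum>A\<in>Pow B. f A) + (\<Sum>A\<in>Pow B. f (insert x A))"
proof -
  have "inj_on (insert x) (Pow B)" using assms(2) by (intro inj_on_inverseI[of _ "\<lambda>A. A - {x}"]) auto
  moreover have "Pow B \<inter> insert x ` Pow B = {}" using assms(2) by blast
  ultimately show ?thesis
    using assms(1) by (simp add: Pow_insert sum.union_disjoint sum.reindex)
qed

text \<open>
  Both sides run over the ordered partitions of \<open>S\<close> into three parts.  This is what makes nested
  convolutions comparable.
\<close>

lemma sum_Pow_assoc:
  assumes "finite S"
  shows "(\<Sum>C\<in>Pow S. \<Sum>A\<in>Pow C. f A (C - A) (S - C))
       = (\<Sum>A\<in>Pow S. \<Sum>B\<in>Pow (S - A). f A B (S - A - B))"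
proof -
  have fin: "finite (Pow X)" if "X \<subseteq> S" for X using assms that finite_subset by auto
  have "(\<Sum>C\<in>Pow S. \<Sum>A\<in>Pow C. f A (C - A) (S - C))
      = (\<Sum>(C, A)\<in>Sigma (Pow S) Pow. f A (C - A) (S - C))"
    by (rule sum.Sigma) (use fin in auto)
  also have "\<dots> = (\<Sum>(A, B)\<in>Sigma (Pow S) (\<lambda>A. Pow (S - A)). f A B (S - A - B))"
    by (rule sum.reindex_bij_witness[of _ "\<lambda>(A, B). (A \<union> B, A)" "\<lambda>(C, A). (A, C - A)"])
       (auto intro!: arg_cong2[of _ _ _ _ "f _"])
  also have "\<dots> = (\<Sum>A\<in>Pow S. \<Sum>B\<in>Pow (S - A). f A B (S - A - B))"
    by (rule sum.Sigma[symmetric]) (use fin in auto)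
  finally show ?thesis .
qed

lemma sum_Pow_rotate:
  assumes "finite S"
  shows "(\<Sum>A\<in>Pow S. \<Sum>B\<in>Pow (S - A). f A B (S - A - B))
       = (\<Sum>A\<in>Pow S. \<Sum>B\<in>Pow (S - A). f B (S - A - B) A)"
proof -
  have fin: "finite (Pow X)" if "X \<subseteq> S" for X using assms that finite_subset by auto
  have "(\<Sum>A\<in>Pow S. \<Sum>B\<in>Pow (S - A). f A B (S - A - B))
      = (\<Sum>(A, B)\<in>Sigma (Pow S) (\<lambda>A. Pow (S - A)). f A B (S - A - B))"
    by (rule sum.Sigma) (use fin in auto)
  also have "\<dots> = (\<Sum>(A, B)\<in>Sigma (Pow S) (\<lambda>A. Pow (S - A)). f B (S - A - B) A)"
    by (rule sum.reindex_bij_witness[of _ "\<lambda>(A, B). (B, S - A - B)" "\<lambda>(A, B). (S - A - B, A)"])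
       (auto intro!: arg_cong2[of _ _ _ _ "f _"])
  also have "\<dots> = (\<Sum>A\<in>Pow S. \<Sum>B\<in>Pow (S - A). f B (S - A - B) A)"
    by (rule sum.Sigma[symmetric]) (use fin in auto)
  finally show ?thesis .
qed


section \<open>Koszul exponents and decalage\<close>

text \<open>
  Sorting the increasing word of \<open>A\<close> followed by that of \<open>B\<close> exchanges exactly the pairs
  \<open>(i, j)\<close> with \<open>j < i\<close>; each exchange contributes \<open>h i j\<close> to the exponent of the sign.
  Additivity in both sets takes the place of the cocycle identities of Koszul signs.
\<close>

definition crossing :: "(nat \<Rightarrow> nat \<Rightarrow> int) \<Rightarrow> nat set \<Rightarrow> nat set \<Rightarrow> int" where
  "crossing h A B = (\<Sum>i\<in>A. \<Sum>j\<in>B. if j < i then h i j else 0)"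

lemma crossing_empty [simp]: "crossing h {} B = 0" "crossing h A {} = 0"
  by (simp_all add: crossing_def)

lemma crossing_Un_left:
  assumes "finite A" "finite B" "A \<inter> B = {}"
  shows "crossing h (A \<union> B) C = crossing h A C + crossing h B C"
  using assms by (simp add: crossing_def sum.union_disjoint)

lemma crossing_Un_right:
  assumes "finite B" "finite C" "B \<inter> C = {}"
  shows "crossing h A (B \<union> C) = crossing h A B + crossing h A C"
  using assms by (simp add: crossing_def sum.union_disjoint sum.distrib)

abbreviation koszul :: "(nat \<Rightarrow> int) \<Rightarrow> nat set \<Rightarrow> nat set \<Rightarrow> int" where
  "koszul p \<equiv> crossing (\<lambda>i j. p i * p j)"

lemma koszul_swap:
  assumes "finite A" "finite B" "A \<inter> B = {}"
  shows "koszul p A B + koszul p B A = sum p A * sum p B"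
proof -
  have "koszul p B A = (\<Sum>i\<in>A. \<Sum>j\<in>B. if i < j then p j * p i else 0)"
    unfolding crossing_def by (rule sum.swap)
  then have "koszul p A B + koszul p B A
      = (\<Sum>i\<in>A. \<Sum>j\<in>B. (if j < i then p i * p j else 0) + (if i < j then p j * p i else 0))"
    by (simp add: crossing_def sum.distrib)
  also have "\<dots> = (\<Sum>i\<in>A. \<Sum>j\<in>B. p i * p j)"
    using assms(3) by (intro sum.cong refl) (auto simp: neq_iff)
  finally show ?thesis by (simp add: sum_product)
qed

lemma koszul_cong:
  assumes "\<And>i. i \<in> A \<union> B \<Longrightarrow> p i = q i"
  shows "koszul p A B = koszul q A B"
  unfolding crossing_def using assms by (intro sum.cong refl) auto

text \<open>
  The graded exterior algebra in degrees \<open>dg\<close> is isomorphic to the graded symmetric algebra in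
  degrees \<open>dg - 1\<close>; this is the exponent of the sign by which the isomorphism rescales the
  increasing monomial of \<open>S\<close>.
\<close>

definition decalage :: "(nat \<Rightarrow> int) \<Rightarrow> nat set \<Rightarrow> int" where
  "decalage dg S = (\<Sum>i\<in>S. \<Sum>j\<in>S. if i < j then dg i else 0)"

lemma decalage_Un:
  assumes "finite A" "finite B" "A \<inter> B = {}"
  shows "decalage dg (A \<union> B) = decalage dg A + decalage dg B + int (card B) * sum dg A
           + crossing (\<lambda>i j. dg j - dg i) A B"
proof -
  have *: "(\<Sum>i\<in>B. \<Sum>j\<in>A. if i < j then dg i else 0) = (\<Sum>i\<in>A. \<Sum>j\<in>B. if j < i then dg j else 0)"
    by (rule sum.swap)
  have "(\<Sum>i\<in>A. \<Sum>j\<in>B. if i < j then dg i else 0) + (\<Sum>i\<in>A. \<Sum>j\<in>B. if j < i then dg j else 0)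
     = (\<Sum>i\<in>A. \<Sum>j\<in>B. dg i + (if j < i then dg j - dg i else 0))"
    unfolding sum.distrib[symmetric] using assms(3) by (intro sum.cong refl) (auto simp: neq_iff)
  also have "\<dots> = int (card B) * sum dg A + crossing (\<lambda>i j. dg j - dg i) A B"
    by (simp add: crossing_def sum.distrib sum_distrib_left)
  finally show ?thesis
    using assms by (simp add: decalage_def sum.union_disjoint sum.distrib *)
qed

lemma decalage_insert_0:
  assumes "finite B" "0 \<notin> B"
  shows "decalage dg (insert 0 B) = int (card B) * dg 0 + decalage dg B"
proof -
  have "crossing (\<lambda>i j. dg j - dg i) {0} B = 0" by (simp add: crossing_def)
  moreover have "decalage dg {0} = 0" by (simp add: decalage_def)
  ultimately show ?thesis using decalage_Un[of "{0}" B dg] assms by simp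
qed

text \<open>
  The exterior sign of an exchange and the coboundary of \<open>decalage\<close> combine to the symmetric sign
  of the shifted degrees, since
  \<open>1 + dg i * dg j + dg j - dg i = (dg i - 1) * (dg j - 1) + 2 * dg j\<close>.
\<close>

lemma even_crossing_decalage:
  "even (crossing (\<lambda>i j. 1 + dg i * dg j) A B + crossing (\<lambda>i j. dg j - dg i) A B
       - koszul (\<lambda>i. dg i - 1) A B)"
proof -
  have "crossing (\<lambda>i j. 1 + dg i * dg j) A B + crossing (\<lambda>i j. dg j - dg i) A B
       - koszul (\<lambda>i. dg i - 1) A B = (\<Sum>i\<in>A. \<Sum>j\<in>B. if j < i then 2 * dg j else 0)"
    unfolding crossing_def sum.distrib[symmetric] sum_subtractf[symmetric]
    by (intro sum.cong refl) (auto simp: algebra_simps)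
  moreover have "even \<dots>" by (intro dvd_sum) auto
  ultimately show ?thesis by simp
qed


section \<open>The exterior sign as a cocycle\<close>

definition pairs_below :: "nat \<Rightarrow> (nat \<times> nat) set" where
  "pairs_below n = {(i, j). i < j \<and> j < n}"

lemma finite_pairs_below [simp]: "finite (pairs_below n)"
  by (rule finite_subset[of _ "{..<n} \<times> {..<n}"]) (auto simp: pairs_below_def)

lemma chi_pairs:
  "chi \<sigma> ds = (\<Prod>(i, j)\<in>pairs_below (length ds).
      if \<sigma> j < \<sigma> i then - ksgn (ds ! \<sigma> i * ds ! \<sigma> j) else 1)"
proof -
  have "inversions (length ds) \<sigma> = {x \<in> pairs_below (length ds). \<sigma> (snd x) < \<sigma> (fst x)}"
    by (auto simp: inversions_def pairs_below_def)
  then show ?thesis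
    unfolding chi_def
    by (simp add: prod.inter_filter case_prod_unfold)
qed

text \<open>
  A symmetric function of pairs is a function of two-element subsets, which \<open>\<tau>\<close> permutes.
\<close>

lemma prod_pairs_permute:
  fixes g :: "nat \<Rightarrow> nat \<Rightarrow> 'k::comm_monoid_mult"
  assumes \<tau>: "\<tau> permutes {..<n}" and sym: "\<And>i j. g i j = g j i"
  shows "(\<Prod>(i, j)\<in>pairs_below n. g (\<tau> i) (\<tau> j)) = (\<Prod>(i, j)\<in>pairs_below n. g i j)"
proof -
  let ?s = "\<lambda>\<tau> (i, j). if \<tau> i < \<tau> j then (\<tau> i, \<tau> j) else (\<tau> j, \<tau> i :: nat)"
  have lt: "\<rho> i < n \<longleftrightarrow> i < n" if "\<rho> permutes {..<n}" for \<rho> i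
    using permutes_in_image[OF that, of i] by simp
  have inv: "inv \<tau> permutes {..<n}" using \<tau> by (rule permutes_inv)
  have ne: "\<rho> i \<noteq> \<rho> j" if "\<rho> permutes {..<n}" "i \<noteq> j" for \<rho> i j
    using permutes_inj[OF that(1)] that(2) by (simp add: inj_eq)
  have mem: "?s \<rho> x \<in> pairs_below n" if "\<rho> permutes {..<n}" "x \<in> pairs_below n" for \<rho> x
  proof -
    obtain i j where x: "x = (i, j)" by (cases x)
    then have "i < j" "i < n" "j < n" using that(2) by (auto simp: pairs_below_def)
    moreover have "\<rho> i < n" "\<rho> j < n" using calculation by (simp_all add: lt[OF that(1)])
    moreover have "\<rho> i \<noteq> \<rho> j" using calculation ne[OF that(1)] by simp
    ultimately show ?thesis by (simp add: x pairs_below_def)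
  qed
  show ?thesis
  proof (rule prod.reindex_bij_witness[of _ "?s (inv \<tau>)" "?s \<tau>"])
    fix x assume x: "x \<in> pairs_below n"
    then obtain i j where ij: "x = (i, j)" "i < j" by (auto simp: pairs_below_def)
    show "?s \<tau> x \<in> pairs_below n" "?s (inv \<tau>) x \<in> pairs_below n"
      using mem[OF \<tau> x] mem[OF inv x] .
    show "?s (inv \<tau>) (?s \<tau> x) = x" "?s \<tau> (?s (inv \<tau>) x) = x"
      using ij by (simp_all add: permutes_inverses[OF \<tau>])
    show "(case ?s \<tau> x of (i, j) \<Rightarrow> g i j) = (case x of (i, j) \<Rightarrow> g (\<tau> i) (\<tau> j))"
      using sym[of "\<tau> j" "\<tau> i"] by (simp add: ij)
  qed
qed

text \<open>
  A pair of positions is inverted by \<open>\<sigma> \<circ> \<tau>\<close> iff exactly one of the following holds: \<open>\<tau>\<close> inverts it, or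
  \<open>\<sigma>\<close> inverts its image under \<open>\<tau>\<close>.  A pair for which both hold contributes twice the same sign
  to the right-hand side, and these cancel.
\<close>

lemma chi_comp:
  assumes \<sigma>: "\<sigma> permutes {..<length ds}" and \<tau>: "\<tau> permutes {..<length ds}"
  shows "chi (\<sigma> \<circ> \<tau>) ds = chi \<sigma> ds * (chi \<tau> (permute_list \<sigma> ds) :: 'k::comm_ring_1)"
proof -
  let ?n = "length ds"
  define s :: "nat \<Rightarrow> nat \<Rightarrow> 'k" where "s = (\<lambda>i j. - ksgn (ds ! \<sigma> i * ds ! \<sigma> j))"
  \<comment> \<open>the sign of the pair of values of \<open>\<sigma>\<close> at \<open>i\<close> and \<open>j\<close>, if \<open>\<sigma>\<close> inverts them, in either order\<close>
  define g where "g = (\<lambda>i j. if (i < j) = (\<sigma> j < \<sigma> i) \<and> i \<noteq> j then s i j else 1)"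
  have s_sym: "s i j = s j i" for i j by (simp add: s_def mult.commute)
  have ss: "s i j * s i j = 1" for i j by (simp add: s_def)
  have inj\<sigma>: "\<sigma> i = \<sigma> j \<longleftrightarrow> i = j" for i j using permutes_inj[OF \<sigma>] by (simp add: inj_eq)
  have inj\<tau>: "\<tau> i = \<tau> j \<longleftrightarrow> i = j" for i j using permutes_inj[OF \<tau>] by (simp add: inj_eq)
  have g_sym: "g i j = g j i" for i j
    using s_sym[of i j] inj\<sigma>[of i j] by (auto simp: g_def)
  have "chi \<sigma> ds = (\<Prod>(i, j)\<in>pairs_below ?n. g i j)"
    unfolding chi_pairs by (intro prod.cong refl) (auto simp: g_def s_def pairs_below_def)
  also have "\<dots> = (\<Prod>(i, j)\<in>pairs_below ?n. g (\<tau> i) (\<tau> j))"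
    by (rule prod_pairs_permute[OF \<tau> g_sym, symmetric])
  finally have 1: "chi \<sigma> ds = (\<Prod>(i, j)\<in>pairs_below ?n. g (\<tau> i) (\<tau> j))" .
  have lt: "\<tau> i < ?n" if "i < ?n" for i using permutes_in_image[OF \<tau>, of i] that by simp
  have 2: "chi \<tau> (permute_list \<sigma> ds)
      = (\<Prod>(i, j)\<in>pairs_below ?n. if \<tau> j < \<tau> i then s (\<tau> i) (\<tau> j) else 1)"
    unfolding chi_pairs length_permute_list
    by (intro prod.cong refl) (auto simp: s_def pairs_below_def permute_list_nth[OF \<sigma>] lt)
  have 3: "(if \<sigma> (\<tau> j) < \<sigma> (\<tau> i) then s (\<tau> i) (\<tau> j) else 1)
        = g (\<tau> i) (\<tau> j) * (if \<tau> j < \<tau> i then s (\<tau> i) (\<tau> j) else 1)"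
    if "i < j" for i j
    using that inj\<tau>[of i j] inj\<sigma>[of "\<tau> i" "\<tau> j"] ss[of "\<tau> i" "\<tau> j"]
    by (auto simp: g_def neq_iff)
  have "chi (\<sigma> \<circ> \<tau>) ds = (\<Prod>(i, j)\<in>pairs_below ?n. if \<sigma> (\<tau> j) < \<sigma> (\<tau> i) then s (\<tau> i) (\<tau> j) else 1)"
    unfolding chi_pairs by (simp only: o_apply s_def)
  also have "\<dots> = (\<Prod>(i, j)\<in>pairs_below ?n. g (\<tau> i) (\<tau> j) * (if \<tau> j < \<tau> i then s (\<tau> i) (\<tau> j) else 1))"
    using 3 by (intro prod.cong refl) (auto simp: pairs_below_def)
  also have "\<dots> = chi \<sigma> ds * chi \<tau> (permute_list \<sigma> ds)"
    unfolding 1 2 prod.distrib[symmetric] by (intro prod.cong refl) auto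
  finally show ?thesis .
qed

lemma chi_square: "chi \<sigma> ds * chi \<sigma> ds = (1 :: 'k::comm_ring_1)"
  unfolding chi_def prod.distrib[symmetric] by (intro prod.neutral) auto

text \<open>
  The antisymmetry of every map of the form \<open>T \<circ> \<alpha>\<^sub>n\<close>: reindex the sum by \<open>\<tau> \<mapsto> \<sigma> \<circ> \<tau>\<close>.
\<close>

lemma comp_alpha_permute:
  assumes "module scale" and len: "length ds = length xs" and \<sigma>: "\<sigma> permutes {..<length xs}"
  shows "comp_alpha scale T (permute_list \<sigma> ds) (permute_list \<sigma> xs)
       = scale (chi \<sigma> ds) (comp_alpha scale T ds xs)"
proof -
  interpret module scale by fact
  let ?n = "length xs"
  let ?h = "\<lambda>\<rho>. scale (chi \<sigma> ds * chi \<rho> ds) (T (permute_list \<rho> ds) (permute_list \<rho> xs))"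
  have "comp_alpha scale T (permute_list \<sigma> ds) (permute_list \<sigma> xs)
      = (\<Sum>\<tau> | \<tau> permutes {..<?n}. ?h (\<sigma> \<circ> \<tau>))"
    unfolding comp_alpha_def length_permute_list
  proof (intro sum.cong refl)
    fix \<tau> assume "\<tau> \<in> {\<tau>. \<tau> permutes {..<?n}}"
    then have \<tau>: "\<tau> permutes {..<?n}" by simp
    have "chi (\<sigma> \<circ> \<tau>) ds = chi \<sigma> ds * (chi \<tau> (permute_list \<sigma> ds) :: 'a)"
      using \<sigma> \<tau> len by (intro chi_comp) simp_all
    then have "chi \<sigma> ds * chi (\<sigma> \<circ> \<tau>) ds = (chi \<tau> (permute_list \<sigma> ds) :: 'a)"
      by (simp add: chi_square flip: mult.assoc)
    then show "scale (chi \<tau> (permute_list \<sigma> ds))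
        (T (permute_list \<tau> (permute_list \<sigma> ds)) (permute_list \<tau> (permute_list \<sigma> xs))) = ?h (\<sigma> \<circ> \<tau>)"
      using \<tau> len by (simp add: permute_list_compose)
  qed
  also have "\<dots> = (\<Sum>\<rho> | \<rho> permutes {..<?n}. ?h \<rho>)"
    by (rule setum_permutations_compose_left[OF \<sigma>, symmetric])
  also have "\<dots> = scale (chi \<sigma> ds) (comp_alpha scale T ds xs)"
    by (simp add: comp_alpha_def scale_sum_right)
  finally show ?thesis .
qed


section \<open>Permutations as words, shuffles as subsets\<close>

text \<open>
  The exponent of the exterior sign that sorts a word without repetitions, computed by moving its
  letters one after the other.  Words are used in place of permutations since a word, unlike a
  permutation, can be cut in two.
\<close>

fun word_exponent :: "(nat \<Rightarrow> int) \<Rightarrow> nat list \<Rightarrow> int" where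
  "word_exponent dg [] = 0"
| "word_exponent dg (x # ws)
     = (\<Sum>y\<leftarrow>ws. if y < x then 1 + dg x * dg y else 0) + word_exponent dg ws"

lemma word_exponent_append:
  assumes "distinct (us @ vs)"
  shows "word_exponent dg (us @ vs) = word_exponent dg us + word_exponent dg vs
           + crossing (\<lambda>i j. 1 + dg i * dg j) (set us) (set vs)"
  using assms
  by (induction us) (auto simp: crossing_def sum_list_distinct_conv_sum_set)

lemma prod_pairs_Suc:
  fixes g :: "nat \<Rightarrow> nat \<Rightarrow> 'k::comm_monoid_mult"
  shows "(\<Prod>(i, j)\<in>pairs_below (Suc n). g i j)
       = (\<Prod>j<n. g 0 (Suc j)) * (\<Prod>(i, j)\<in>pairs_below n. g (Suc i) (Suc j))"
proof -
  have eq: "pairs_below (Suc n) = (\<lambda>j. (0, Suc j)) ` {..<n} \<union> map_prod Suc Suc ` pairs_below n"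
  proof (intro set_eqI iffI)
    fix x assume "x \<in> pairs_below (Suc n)"
    then obtain i j where x: "x = (i, Suc j)" "i < Suc j" "j < n"
      by (cases x; cases "snd x") (auto simp: pairs_below_def)
    show "x \<in> (\<lambda>j. (0, Suc j)) ` {..<n} \<union> map_prod Suc Suc ` pairs_below n"
    proof (cases i)
      case (Suc k)
      then have "x = map_prod Suc Suc (k, j)" "(k, j) \<in> pairs_below n"
        using x by (auto simp: pairs_below_def)
      then show ?thesis by blast
    qed (use x in auto)
  qed (auto simp: pairs_below_def)
  have inj: "inj_on (map_prod Suc Suc) (pairs_below n)" by (auto intro!: inj_onI)
  have "(\<Prod>(i, j)\<in>pairs_below (Suc n). g i j)
      = prod (case_prod g) ((\<lambda>j. (0, Suc j)) ` {..<n}) * prod (case_prod g) (map_prod Suc Suc ` pairs_below n)"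
    unfolding eq by (rule prod.union_disjoint) auto
  also have "prod (case_prod g) ((\<lambda>j. (0, Suc j)) ` {..<n}) = (\<Prod>j<n. g 0 (Suc j))"
    by (subst prod.reindex) (auto simp: inj_on_def)
  also have "prod (case_prod g) (map_prod Suc Suc ` pairs_below n)
      = (\<Prod>(i, j)\<in>pairs_below n. g (Suc i) (Suc j))"
    by (subst prod.reindex[OF inj]) (auto simp: case_prod_unfold)
  finally show ?thesis .
qed

lemma ksgn_word_exponent:
  "ksgn (word_exponent dg ws) = (\<Prod>(i, j)\<in>pairs_below (length ws).
      if ws ! j < ws ! i then - ksgn (dg (ws ! i) * dg (ws ! j)) else (1 :: 'k::comm_ring_1))"
proof (induction ws)
  case Nil
  then show ?case by (simp add: pairs_below_def)
next
  case (Cons x ws)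
  have *: "ksgn (sum_list (map h ws)) = (\<Prod>j<length ws. ksgn (h (ws ! j)) :: 'k)" for h
    by (induction ws) (simp_all add: ksgn_add prod.lessThan_Suc_shift del: prod.lessThan_Suc)
  have "ksgn (\<Sum>y\<leftarrow>ws. if y < x then 1 + dg x * dg y else 0)
     = (\<Prod>j<length ws. if ws ! j < x then - ksgn (dg x * dg (ws ! j)) else (1 :: 'k))"
    unfolding * by (intro prod.cong refl) (simp add: ksgn_one_plus)
  then show ?case by (simp add: ksgn_add Cons.IH prod_pairs_Suc cong: if_cong)
qed

lemma chi_word_exponent:
  assumes s: "sorted_wrt (<) s" and \<sigma>: "\<sigma> permutes {..<length s}"
  shows "chi \<sigma> (map dg s) = (ksgn (word_exponent dg (permute_list \<sigma> s)) :: 'k::comm_ring_1)"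
proof -
  have lt: "\<sigma> i < length s" if "i < length s" for i
    using permutes_in_image[OF \<sigma>, of i] that by simp
  have nth_less: "s ! i < s ! j \<longleftrightarrow> i < j" if "i < length s" "j < length s" for i j
    using s that sorted_wrt_nth_less[OF s] by (metis linorder_neqE_nat order_less_asym order_less_irrefl)
  show ?thesis
    unfolding chi_pairs ksgn_word_exponent length_map length_permute_list
    by (intro prod.cong refl)
       (auto simp: pairs_below_def permute_list_nth[OF \<sigma>] nth_less lt)
qed

lemma inj_on_permute_list:
  assumes s: "distinct s"
  shows "inj_on (\<lambda>\<sigma>. permute_list \<sigma> s) {\<sigma>. \<sigma> permutes {..<length s}}"
proof (rule inj_onI, clarsimp)
  fix \<sigma> \<tau> assume a: "\<sigma> permutes {..<length s}" "\<tau> permutes {..<length s}"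
    and eq: "permute_list \<sigma> s = permute_list \<tau> s"
  show "\<sigma> = \<tau>"
  proof
    fix i
    show "\<sigma> i = \<tau> i"
    proof (cases "i < length s")
      case True
      then have "s ! \<sigma> i = s ! \<tau> i" using a eq permute_list_nth by metis
      moreover have "\<sigma> i < length s" "\<tau> i < length s"
        using permutes_in_image[OF a(1), of i] permutes_in_image[OF a(2), of i] True by auto
      ultimately show ?thesis using s nth_eq_iff_index_eq by blast
    next
      case False
      then show ?thesis using a by (simp add: permutes_def)
    qed
  qed
qed

lemma sum_permutes_permutations_of_set:
  assumes s: "distinct s"
  shows "(\<Sum>\<sigma> | \<sigma> permutes {..<length s}. f (permute_list \<sigma> s)) = (\<Sum>ws\<in>permutations_of_set (set s). f ws)"
proof (rule sum.reindex_bij_betw)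
  have "(\<lambda>\<sigma>. permute_list \<sigma> s) ` {\<sigma>. \<sigma> permutes {..<length s}} = permutations_of_set (set s)"
  proof (intro equalityI subsetI)
    fix ws assume "ws \<in> permutations_of_set (set s)"
    then have "mset ws = mset s"
      using s by (metis permutations_of_setD set_eq_iff_mset_eq_distinct)
    then obtain \<sigma> where "\<sigma> permutes {..<length s}" "permute_list \<sigma> s = ws"
      by (rule mset_eq_permutation)
    then show "ws \<in> (\<lambda>\<sigma>. permute_list \<sigma> s) ` {\<sigma>. \<sigma> permutes {..<length s}}" by blast
  qed (use s in \<open>auto simp: permutations_of_set_def\<close>)
  then show "bij_betw (\<lambda>\<sigma>. permute_list \<sigma> s) {\<sigma>. \<sigma> permutes {..<length s}} (permutations_of_set (set s))"
    using inj_on_permute_list[OF s] by (simp add: bij_betw_def)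
qed

lemma word_exponent_sorted: "sorted_wrt (<) ws \<Longrightarrow> word_exponent dg ws = 0"
proof (induction ws)
  case (Cons x ws)
  then have "(\<Sum>y\<leftarrow>ws. if y < x then 1 + dg x * dg y else 0) = (\<Sum>y\<leftarrow>ws. 0)"
    by (intro arg_cong[where f = sum_list] map_cong) auto
  then show ?case using Cons by simp
qed simp

lemma sorted_list_of_set_sorted_wrt:
  fixes ws :: "nat list"
  assumes "sorted_wrt (<) ws"
  shows "sorted_list_of_set (set ws) = ws"
  using assms by (intro sorted_list_of_set.idem_if_sorted_distinct) (auto simp: strict_sorted_iff)

text \<open>
  A \<open>(k, n - k)\<close>-shuffle is determined by the set of entries at its first \<open>k\<close> positions, because
  each of the two blocks is increasing.  As \<open>k \<ge> 1\<close> and \<open>l \<ge> 1\<close>, all nonempty subsets occur.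
\<close>

lemma sum_shuffles:
  fixes s :: "nat list"
  assumes s: "sorted_wrt (<) s" and n: "length s = n"
  shows "(\<Sum>(k, l) | 1 \<le> k \<and> 1 \<le> l \<and> k + l = n + 1. \<Sum>\<sigma>\<in>Sh k n. F k l (permute_list \<sigma> s))
       = (\<Sum>A\<in>Pow (set s) - {{}}. F (card A) (n + 1 - card A)
            (sorted_list_of_set A @ sorted_list_of_set (set s - A)))"
proof -
  let ?K = "{(k, l). 1 \<le> k \<and> 1 \<le> l \<and> k + l = n + 1}"
  let ?D = "Sigma ?K (\<lambda>(k, l). Sh k n)"
  let ?f = "\<lambda>((k, l), \<sigma>). set (take k (permute_list \<sigma> s))"
  have dist: "distinct s" and card_s: "card (set s) = n"
    using s n by (auto simp: strict_sorted_iff distinct_card)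
  have nth_less: "s ! i < s ! j \<longleftrightarrow> i < j" if "i < n" "j < n" for i j
    using that sorted_wrt_nth_less[OF s] n by (metis linorder_neqE_nat order_less_asym order_less_irrefl)
  have split: "take k (permute_list \<sigma> s) = sorted_list_of_set A
      \<and> drop k (permute_list \<sigma> s) = sorted_list_of_set (set s - A)
      \<and> card A = k \<and> A \<subseteq> set s"
    if "k \<le> n" "\<sigma> \<in> Sh k n" "A = set (take k (permute_list \<sigma> s))" for k \<sigma> A
  proof -
    let ?ws = "permute_list \<sigma> s"
    have \<sigma>: "\<sigma> permutes {..<length s}" "strict_mono_on {..<k} \<sigma>" "strict_mono_on {k..<n} \<sigma>"
      using that n by (auto simp: Sh_def)
    have lt: "\<sigma> i < n" if "i < n" for i using permutes_in_image[OF \<sigma>(1), of i] that n by simp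
    have ws: "set ?ws = set s" "distinct ?ws" using \<sigma>(1) dist by simp_all
    have "sorted_wrt (<) (take k ?ws)"
      using \<sigma>(2) that(1) n lt by (auto simp: sorted_wrt_iff_nth_less permute_list_nth[OF \<sigma>(1)] nth_less strict_mono_on_def)
    then have 1: "take k ?ws = sorted_list_of_set A" using that(3) sorted_list_of_set_sorted_wrt by simp
    have "\<sigma> (k + i) < \<sigma> (k + j)" if "i < j" "j < n - k" for i j
      using that by (intro strict_mono_onD[OF \<sigma>(3)]) auto
    then have "sorted_wrt (<) (drop k ?ws)"
      using that(1) n lt by (auto simp: sorted_wrt_iff_nth_less permute_list_nth[OF \<sigma>(1)] nth_less)
    moreover have "set (take k ?ws) \<union> set (drop k ?ws) = set s"
      using ws(1) by (simp flip: set_append)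
    moreover have "set (take k ?ws) \<inter> set (drop k ?ws) = {}"
      using ws(2) by (simp add: set_take_disj_set_drop_if_distinct)
    ultimately have sub: "set (drop k ?ws) = set s - A" "A \<subseteq> set s"
      and sorted: "sorted_wrt (<) (drop k ?ws)"
      using that(3) by auto
    have 2: "drop k ?ws = sorted_list_of_set (set s - A)"
      using sorted_list_of_set_sorted_wrt[OF sorted] sub(1) by simp
    have "card A = k" using that(1,3) ws(2) n by (simp add: distinct_card)
    then show ?thesis using 1 2 sub(2) by blast
  qed
  have inj: "inj_on ?f ?D"
  proof (rule inj_onI)
    fix x y assume x: "x \<in> ?D" and y: "y \<in> ?D" and eq: "?f x = ?f y"
    obtain k l \<sigma> where x_eq: "x = ((k, l), \<sigma>)" "k \<le> n" "l = n + 1 - k" "\<sigma> \<in> Sh k n" using x by auto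
    obtain k' l' \<tau> where y_eq: "y = ((k', l'), \<tau>)" "k' \<le> n" "l' = n + 1 - k'" "\<tau> \<in> Sh k' n" using y by auto
    obtain A where A: "A = set (take k (permute_list \<sigma> s))" "A = set (take k' (permute_list \<tau> s))"
      using eq x_eq y_eq by simp
    note sp = split[OF x_eq(2,4) A(1)] split[OF y_eq(2,4) A(2)]
    have k: "k = k'" using sp by simp
    have "permute_list \<sigma> s = take k (permute_list \<sigma> s) @ drop k (permute_list \<sigma> s)" by simp
    also have "\<dots> = take k' (permute_list \<tau> s) @ drop k' (permute_list \<tau> s)"
      using sp by (simp only:)
    finally have ws: "permute_list \<sigma> s = permute_list \<tau> s" by simp
    have \<sigma>: "\<sigma> permutes {..<length s}" and \<tau>: "\<tau> permutes {..<length s}"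
      using x_eq y_eq n by (auto simp: Sh_def)
    have "\<sigma> = \<tau>" using inj_onD[OF inj_on_permute_list[OF dist], of \<sigma> \<tau>] ws \<sigma> \<tau> by simp
    then show "x = y" using x_eq y_eq k by simp
  qed
  have img: "?f ` ?D = Pow (set s) - {{}}"
  proof (intro equalityI subsetI)
    fix A assume "A \<in> ?f ` ?D"
    then obtain k \<sigma> where "1 \<le> k" "k \<le> n" "\<sigma> \<in> Sh k n" "A = set (take k (permute_list \<sigma> s))" by auto
    then show "A \<in> Pow (set s) - {{}}" using split[of k \<sigma> A] by auto
  next
    fix A assume A: "A \<in> Pow (set s) - {{}}"
    then have fA: "finite A" by (auto intro: finite_subset)
    let ?ws = "sorted_list_of_set A @ sorted_list_of_set (set s - A)"
    have card: "0 < card A" "card A \<le> n" using A fA card_s by (auto simp: card_gt_0_iff intro: card_mono)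
    have "distinct ?ws" "set ?ws = set s" using A fA by auto
    then have "mset s = mset ?ws" using dist set_eq_iff_mset_eq_distinct by metis
    then obtain \<sigma> where \<sigma>: "\<sigma> permutes {..<length s}" "permute_list \<sigma> s = ?ws"
      by (metis mset_eq_permutation)
    have lt: "\<sigma> i < n" if "i < n" for i using permutes_in_image[OF \<sigma>(1), of i] that n by simp
    have ws_nth: "?ws ! i = s ! \<sigma> i" if "i < n" for i
      using permute_list_nth[OF \<sigma>(1), of i] that n \<sigma>(2) by simp
    have len: "length (sorted_list_of_set A) = card A" "length (sorted_list_of_set (set s - A)) = n - card A"
      using A fA card_s by (auto simp: card_Diff_subset)
    have "\<sigma> i < \<sigma> j" if "i < j" "j < card A" for i j
    proof -
      have "sorted_list_of_set A ! i < sorted_list_of_set A ! j"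
        using that len(1) sorted_wrt_nth_less[of "(<)" "sorted_list_of_set A" i j] by simp
      then have "s ! \<sigma> i < s ! \<sigma> j" using that card len(1) ws_nth[of i] ws_nth[of j] by (simp add: nth_append)
      then show ?thesis using nth_less[of "\<sigma> i" "\<sigma> j"] lt[of i] lt[of j] that card by simp
    qed
    moreover have "\<sigma> i < \<sigma> j" if "i < j" "j < n" "card A \<le> i" for i j
    proof -
      have "sorted_list_of_set (set s - A) ! (i - card A) < sorted_list_of_set (set s - A) ! (j - card A)"
        using that len(2) sorted_wrt_nth_less[of "(<)" "sorted_list_of_set (set s - A)" "i - card A" "j - card A"] by simp
      then have "s ! \<sigma> i < s ! \<sigma> j" using that len(1) ws_nth[of i] ws_nth[of j] by (simp add: nth_append)
      then show ?thesis using nth_less[of "\<sigma> i" "\<sigma> j"] lt[of i] lt[of j] that by simp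
    qed
    ultimately have "\<sigma> \<in> Sh (card A) n"
      using \<sigma>(1) n by (auto simp: Sh_def strict_mono_on_def)
    then have "((card A, n + 1 - card A), \<sigma>) \<in> ?D" using card by auto
    moreover have "?f ((card A, n + 1 - card A), \<sigma>) = A" using \<sigma>(2) len fA by simp
    ultimately show "A \<in> ?f ` ?D" by (metis (no_types, lifting) image_eqI)
  qed
  have finK: "finite ?K" by (rule finite_subset[of _ "{..n} \<times> {..n}"]) auto
  have finSh: "finite (Sh k n)" for k
    by (rule finite_subset[of _ "{\<sigma>. \<sigma> permutes {..<n}}"]) (auto simp: Sh_def finite_permutations)
  let ?G = "\<lambda>A. F (card A) (n + 1 - card A) (sorted_list_of_set A @ sorted_list_of_set (set s - A))"
  have "(\<Sum>(k, l)\<in>?K. \<Sum>\<sigma>\<in>Sh k n. F k l (permute_list \<sigma> s))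
      = (\<Sum>x\<in>?K. \<Sum>\<sigma>\<in>(case x of (k, l) \<Rightarrow> Sh k n). F (fst x) (snd x) (permute_list \<sigma> s))"
    by (intro sum.cong refl) auto
  also have "\<dots> = (\<Sum>(x, \<sigma>)\<in>?D. F (fst x) (snd x) (permute_list \<sigma> s))"
    by (rule sum.Sigma) (use finK finSh in auto)
  also have "\<dots> = (\<Sum>x\<in>?D. ?G (?f x))"
  proof (intro sum.cong refl)
    fix x assume "x \<in> ?D"
    then obtain k l \<sigma> where x: "x = ((k, l), \<sigma>)" "k \<le> n" "l = n + 1 - k" "\<sigma> \<in> Sh k n" by auto
    obtain A where A: "A = set (take k (permute_list \<sigma> s))" by simp
    note sp = split[OF x(2,4) A]
    have fx: "?f x = A" using x(1) A by simp
    have "permute_list \<sigma> s = take k (permute_list \<sigma> s) @ drop k (permute_list \<sigma> s)" by simp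
    also have "\<dots> = sorted_list_of_set A @ sorted_list_of_set (set s - A)"
      using sp by (simp only:)
    finally show "(case x of (x, \<sigma>) \<Rightarrow> F (fst x) (snd x) (permute_list \<sigma> s)) = ?G (?f x)"
      unfolding fx using sp x by simp
  qed
  also have "\<dots> = (\<Sum>A\<in>Pow (set s) - {{}}. ?G A)"
    by (rule sum.reindex_bij_betw) (use inj img in \<open>simp add: bij_betw_def\<close>)
  finally show ?thesis .
qed


section \<open>The transfer data\<close>

locale homotopy_transfer = dg_lie_algebra scale L d bracket
  for scale :: "'k::comm_ring_1 \<Rightarrow> 'a::ab_group_add \<Rightarrow> 'a" and L :: "int \<Rightarrow> 'a set"
    and d :: "'a \<Rightarrow> 'a" and bracket :: "'a \<Rightarrow> 'a \<Rightarrow> 'a" +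
  fixes \<iota> :: "rat \<Rightarrow> 'k" and \<eta> :: "'a \<Rightarrow> 'a"
  assumes rat: "rat_embedding \<iota>"
    and \<eta>_linear: "module_hom scale scale \<eta>"
    and \<eta>_degree: "\<And>i x. x \<in> L i \<Longrightarrow> \<eta> x \<in> L (i - 1)"
    and d_\<eta>_d: "\<And>x. d (\<eta> (d x)) = d x"
    and \<eta>_\<eta>: "\<And>x. \<eta> (\<eta> x) = 0"
    and \<eta>_d_\<eta>: "\<And>x. \<eta> (d (\<eta> x)) = \<eta> x"
begin

lemma iota_add: "\<iota> (p + q) = \<iota> p + \<iota> q" and iota_mult: "\<iota> (p * q) = \<iota> p * \<iota> q"
  and iota_1: "\<iota> 1 = 1"
  using rat by (auto simp: rat_embedding_def)

lemma iota_minus: "\<iota> (- q) = - \<iota> q"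
proof -
  have "\<iota> 0 + \<iota> 0 = \<iota> 0" using iota_add[of 0 0] by simp
  moreover have "\<iota> q + \<iota> (- q) = \<iota> 0" using iota_add[of q "- q"] by simp
  ultimately show ?thesis by (simp add: eq_neg_iff_add_eq_0 add.commute)
qed

definition half :: "'a \<Rightarrow> 'a" where
  "half = scale (\<iota> (1 / 2))"

lemma half_add_half: "half x + half x = x"
proof -
  have "\<iota> (1 / 2) + \<iota> (1 / 2) = 1"
    unfolding iota_add[symmetric] by (simp add: iota_1)
  then show ?thesis unfolding half_def by (metis scale_left_distrib scale_one)
qed

text \<open>
  The Jacobi identity enters as the vanishing of a sum of three equal terms.
\<close>

lemma triple_eq_0:
  assumes "x + x + x = (0 :: 'a)"
  shows "x = 0"
proof -
  have "\<iota> (1 / 3) + \<iota> (1 / 3) + \<iota> (1 / 3) = 1"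
    unfolding iota_add[symmetric] by (simp add: iota_1)
  then have "x = scale (\<iota> (1 / 3)) x + scale (\<iota> (1 / 3)) x + scale (\<iota> (1 / 3)) x"
    by (metis scale_left_distrib scale_one)
  also have "\<dots> = scale (\<iota> (1 / 3)) (x + x + x)" by (simp add: scale_right_distrib)
  finally show ?thesis using assms by simp
qed

lemma half_linear: "module_hom scale scale half"
  unfolding half_def by (rule module_hom_scale_self)

lemma half_double: "half (x + x) = x"
  by (simp add: module_hom.add[OF half_linear] half_add_half)

definition proj :: "'a \<Rightarrow> 'a" where
  "proj x = x - comm_op d \<eta> x"

lemmas d_simps = module_hom.add[OF d_linear] module_hom.diff[OF d_linear] module_hom.neg[OF d_linear]
  module_hom.zero[OF d_linear] module_hom.scale[OF d_linear]

lemmas \<eta>_simps = module_hom.add[OF \<eta>_linear] module_hom.diff[OF \<eta>_linear] module_hom.neg[OF \<eta>_linear]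
  module_hom.zero[OF \<eta>_linear] module_hom.scale[OF \<eta>_linear]

lemmas half_simps = module_hom.add[OF half_linear] module_hom.diff[OF half_linear]
  module_hom.neg[OF half_linear] module_hom.zero[OF half_linear]

lemmas bracket_add = module_hom.add[OF bracket_linear_left] module_hom.add[OF bracket_linear_right]

lemmas bracket_scale = module_hom.scale[OF bracket_linear_left] module_hom.scale[OF bracket_linear_right]

lemmas bracket_sum = module_hom.sum[OF bracket_linear_left] module_hom.sum[OF bracket_linear_right]

lemmas bracket_neg = module_hom.neg[OF bracket_linear_left] module_hom.neg[OF bracket_linear_right]

lemmas bracket_0 = module_hom.zero[OF bracket_linear_left] module_hom.zero[OF bracket_linear_right]

lemma bracket_sg: "bracket (sg m x) y = sg m (bracket x y)" "bracket x (sg m y) = sg m (bracket x y)"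
  by (simp_all add: sg_def bracket_neg)

lemma hom_sg: "module_hom scale scale f \<Longrightarrow> f (sg m x) = sg m (f x)"
  by (simp add: sg_def module_hom.neg)

lemma comm_op_linear: "module_hom scale scale (comm_op d \<eta>)"
  unfolding comm_op_def
  by (intro module_hom_iff[THEN iffD2] conjI allI module_axioms)
     (simp_all add: d_simps \<eta>_simps scale_right_distrib algebra_simps)

lemma proj_linear: "module_hom scale scale proj"
  unfolding proj_def
  by (intro module_hom_iff[THEN iffD2] conjI allI module_axioms)
     (simp_all add: module_hom.add[OF comm_op_linear] module_hom.scale[OF comm_op_linear]
        scale_right_diff_distrib)

lemma comm_op_proj: "comm_op d \<eta> (proj x) = 0"
  by (simp add: proj_def comm_op_def d_simps \<eta>_simps d_squared \<eta>_\<eta> d_\<eta>_d \<eta>_d_\<eta>)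

lemma proj_d: "proj (d x) = 0"
  by (simp add: proj_def comm_op_def d_squared d_\<eta>_d \<eta>_simps)

text \<open>
  From \<open>d\<eta>x + \<eta>dx = 0\<close> it follows that \<open>0 = d(d\<eta>x + \<eta>dx) = d\<eta>dx = dx\<close>, and likewise \<open>\<eta>x = 0\<close>.
\<close>

lemma ker_iff: "x \<in> ker_comm_op d \<eta> \<longleftrightarrow> d x = 0 \<and> \<eta> x = 0"
proof
  assume "x \<in> ker_comm_op d \<eta>"
  then have *: "d (\<eta> x) + \<eta> (d x) = 0" by (simp add: ker_comm_op_def comm_op_def)
  have "d (d (\<eta> x) + \<eta> (d x)) = d x" by (simp add: d_simps d_squared d_\<eta>_d)
  moreover have "\<eta> (d (\<eta> x) + \<eta> (d x)) = \<eta> x" by (simp add: \<eta>_simps \<eta>_\<eta> \<eta>_d_\<eta>)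
  ultimately show "d x = 0 \<and> \<eta> x = 0" unfolding * by (simp add: d_simps \<eta>_simps)
qed (simp add: ker_comm_op_def comm_op_def d_simps \<eta>_simps)

lemma proj_mem_ker: "proj x \<in> ker_comm_op d \<eta>"
  by (simp add: ker_comm_op_def comm_op_proj)

lemma scale_ksgn: "scale (ksgn m) x = sg m x"
  by (simp add: ksgn_def sg_def)

lemma L_cast: "x \<in> L i \<Longrightarrow> i = j \<Longrightarrow> x \<in> L j"
  by simp

lemmas L_0 = subspace_0[OF subspace_degree]

lemmas L_add = subspace_add[OF subspace_degree]

lemmas L_diff = subspace_diff[OF subspace_degree]

lemmas L_neg = subspace_neg[OF subspace_degree]

lemmas L_scale = subspace_scale[OF subspace_degree]

lemmas L_sum = subspace_sum[OF subspace_degree]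

lemma L_sg: "x \<in> L i \<Longrightarrow> sg m x \<in> L i"
  by (simp add: sg_def L_neg)

lemma proj_degree:
  assumes "x \<in> L i" shows "proj x \<in> L i"
proof -
  have "d (\<eta> x) \<in> L i" "\<eta> (d x) \<in> L i"
    using d_degree[OF \<eta>_degree[OF assms]] \<eta>_degree[OF d_degree[OF assms]] by simp_all
  then show ?thesis by (simp add: proj_def comm_op_def L_diff L_add assms)
qed

lemma bracket_swap:
  assumes "x \<in> L (i + 1)" "y \<in> L (j + 1)"
  shows "bracket x y = sg (i * j + i + j) (bracket y x)"
proof -
  have "bracket x y = scale (ksgn (1 + (i + 1) * (j + 1))) (bracket y x)"
    using bracket_antisym[OF assms] by (simp add: ksgn_one_plus)
  also have "\<dots> = sg (i * j + i + j) (bracket y x)"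
    unfolding scale_ksgn by (rule sg_cong) (simp add: algebra_simps)
  finally show ?thesis .
qed

text \<open>
  The cyclic form of the Jacobi identity, with signs written in the shifted degrees.
\<close>

lemma jacobi_cyclic:
  assumes x: "x \<in> L (i + 1)" and y: "y \<in> L (j + 1)" and z: "z \<in> L (k + 1)"
  shows "bracket (bracket x y) z + sg (i * j + i * k + j + k) (bracket (bracket y z) x)
      + sg (j * k + i * k + i + j) (bracket (bracket z x) y) = 0"
proof -
  have yz: "bracket y z \<in> L ((j + k + 1) + 1)" and zx: "bracket z x \<in> L ((i + k + 1) + 1)"
    using bracket_degree[OF y z] bracket_degree[OF z x] by (simp_all add: ac_simps)
  have "bracket x (bracket y z) = bracket (bracket x y) z + sg ((i + 1) * (j + 1)) (bracket y (bracket x z))"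
    using jacobi[OF x y z] by (simp add: scale_ksgn)
  moreover have "bracket x (bracket y z) = - sg (i * j + i * k + j + k) (bracket (bracket y z) x)"
    unfolding bracket_swap[OF x yz] sg_one_plus[symmetric] by (rule sg_cong) (simp add: algebra_simps)
  moreover have "bracket y (bracket x z) = sg (j * (i + k + 1) + j + (i + k + 1) + (i * k + i + k)) (bracket (bracket z x) y)"
    unfolding bracket_swap[OF x z] bracket_sg bracket_swap[OF y zx] sg_sg
    by (rule sg_cong) simp
  moreover have "sg ((i + 1) * (j + 1)) (sg (j * (i + k + 1) + j + (i + k + 1) + (i * k + i + k)) (bracket (bracket z x) y))
      = sg (j * k + i * k + i + j) (bracket (bracket z x) y)"
    unfolding sg_sg by (rule sg_cong) (simp add: algebra_simps)
  ultimately have "bracket (bracket x y) z + sg (j * k + i * k + i + j) (bracket (bracket z x) y)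
      = - sg (i * j + i * k + j + k) (bracket (bracket y z) x)" by simp
  then show ?thesis by (simp add: eq_neg_iff_add_eq_0 add.assoc add.commute add.left_commute)
qed


section \<open>The dg Lie algebra of functions on finite sets\<close>

text \<open>
  The bracket \<open>[f, g]\<close> of the extended dg Lie algebra: \<open>f A\<close> is the coefficient of the monomial of
  the parameters in \<open>A\<close>, of shifted degree \<open>sum p A\<close>.  The factor \<open>(-1) ^ sum p A\<close> makes the
  operation graded symmetric for the shifted degrees, as in the passage from \<open>L\<close> to \<open>L[1]\<close>.
  Functions that vanish on the empty set are those without constant term; for them the summands
  \<open>A = {}\<close> and \<open>A = S\<close> vanish, as they should since every subtree has a leaf.
\<close>

definition convolve ::
  "(nat \<Rightarrow> int) \<Rightarrow> (nat set \<Rightarrow> 'a) \<Rightarrow> (nat set \<Rightarrow> 'a) \<Rightarrow> nat set \<Rightarrow> 'a" where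
  "convolve p f g S =
     (\<Sum>A\<in>Pow S. sg (sum p A + koszul p A (S - A)) (bracket (f A) (g (S - A))))"

lemma convolve_cong:
  assumes "\<And>A. A \<subseteq> S \<Longrightarrow> f A = f' A" "\<And>A. A \<subseteq> S \<Longrightarrow> g A = g' A"
  shows "convolve p f g S = convolve p f' g' S"
  unfolding convolve_def using assms by (intro sum.cong refl) auto

lemma convolve_add_left:
  "convolve p (\<lambda>A. f A + f' A) g S = convolve p f g S + convolve p f' g S"
  by (simp add: convolve_def bracket_add sg_add sum.distrib)

lemma convolve_neg_left: "convolve p (\<lambda>A. - f A) g S = - convolve p f g S"
  by (simp add: convolve_def bracket_neg sg_minus sum_negf)

lemma convolve_half_left: "convolve p (\<lambda>A. half (f A)) g S = half (convolve p f g S)"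
  by (simp add: convolve_def module_hom.sum[OF half_linear] hom_sg[OF half_linear])
     (simp add: half_def bracket_scale)

lemma convolve_degree:
  assumes "finite S" "\<And>A. A \<subseteq> S \<Longrightarrow> f A \<in> L (sum p A + i)" "\<And>A. A \<subseteq> S \<Longrightarrow> g A \<in> L (sum p A + j)"
  shows "convolve p f g S \<in> L (sum p S + (i + j))"
  unfolding convolve_def
proof (intro L_sum L_sg)
  fix A assume A: "A \<in> Pow S"
  have "sum p S = sum p (S - A) + sum p A" using A assms(1) by (auto intro: sum.subset_diff)
  then show "bracket (f A) (g (S - A)) \<in> L (sum p S + (i + j))"
    using bracket_degree[OF assms(2)[of A] assms(3)[of "S - A"]] A by (auto simp: ac_simps)
qed

lemma convolve_term_swap:
  assumes "finite A" "finite B" "A \<inter> B = {}" "x \<in> L (sum p A + 1)" "y \<in> L (sum p B + 1)"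
  shows "sg (sum p A + koszul p A B) (bracket x y) = sg (sum p B + koszul p B A) (bracket y x)"
proof -
  have *: "koszul p A B = sum p A * sum p B - koszul p B A" using koszul_swap[OF assms(1-3), of p] by simp
  show ?thesis
    unfolding bracket_swap[OF assms(4,5)] sg_sg by (rule sg_cong) (auto simp: *)
qed

text \<open>
  Exchanging the two parts turns the summands \<open>[f A, d (f B)]\<close> of the Leibniz rule into summands
  \<open>[d (f B), f A]\<close>, with the sign that \<open>convolve\<close> prescribes.
\<close>

lemma d_convolve:
  assumes "finite S" and f: "\<And>A. A \<subseteq> S \<Longrightarrow> f A \<in> L (sum p A + 1)"
  shows "d (convolve p f f S) = convolve p (\<lambda>A. d (f A)) f S + convolve p (\<lambda>A. d (f A)) f S"
proof -
  let ?e = "\<lambda>A B. sum p A + koszul p A B"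
  have "d (convolve p f f S) = (\<Sum>A\<in>Pow S. sg (?e A (S - A)) (d (bracket (f A) (f (S - A)))))"
    by (simp add: convolve_def module_hom.sum[OF d_linear] hom_sg[OF d_linear])
  also have "\<dots> = (\<Sum>A\<in>Pow S. sg (?e A (S - A)) (bracket (d (f A)) (f (S - A)))
                    + sg (?e A (S - A) + (sum p A + 1)) (bracket (f A) (d (f (S - A)))))"
  proof (intro sum.cong refl)
    fix A assume "A \<in> Pow S"
    then show "sg (?e A (S - A)) (d (bracket (f A) (f (S - A))))
        = sg (?e A (S - A)) (bracket (d (f A)) (f (S - A)))
          + sg (?e A (S - A) + (sum p A + 1)) (bracket (f A) (d (f (S - A))))"
      using leibniz[OF f[of A] f[of "S - A"]] by (simp add: scale_ksgn sg_add)
  qed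
  also have "\<dots> = convolve p (\<lambda>A. d (f A)) f S
      + (\<Sum>A\<in>Pow S. sg (?e A (S - A) + (sum p A + 1)) (bracket (f A) (d (f (S - A)))))"
    by (simp add: sum.distrib convolve_def)
  also have "(\<Sum>A\<in>Pow S. sg (?e A (S - A) + (sum p A + 1)) (bracket (f A) (d (f (S - A)))))
      = (\<Sum>A\<in>Pow S. sg (?e (S - A) A + (sum p (S - A) + 1)) (bracket (f (S - A)) (d (f A))))"
    using sum_Pow_complement[OF assms(1), of "\<lambda>A B. sg (?e A B + (sum p A + 1)) (bracket (f A) (d (f B)))"] .
  also have "\<dots> = convolve p (\<lambda>A. d (f A)) f S"
    unfolding convolve_def
  proof (intro sum.cong refl)
    fix A assume A: "A \<in> Pow S"
    then have fin: "finite A" "finite (S - A)" using assms(1) by (auto intro: finite_subset)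
    have dfA: "d (f A) \<in> L ((sum p A + 1) + 1)" using d_degree[OF f[of A]] A by simp
    have fB: "f (S - A) \<in> L (sum p (S - A) + 1)" using f by simp
    have *: "koszul p A (S - A) = sum p A * sum p (S - A) - koszul p (S - A) A"
      using koszul_swap[OF fin, of p] by simp
    show "sg (?e (S - A) A + (sum p (S - A) + 1)) (bracket (f (S - A)) (d (f A)))
        = sg (?e A (S - A)) (bracket (d (f A)) (f (S - A)))"
      unfolding bracket_swap[OF fB dfA] sg_sg by (rule sg_cong) (auto simp: *)
  qed
  finally show ?thesis .
qed

lemma convolve_convolve_left:
  assumes "finite S"
  shows "convolve p (convolve p f g) h S
    = (\<Sum>A\<in>Pow S. \<Sum>B\<in>Pow (S - A). sg (sum p B + koszul p A B + koszul p A (S - A - B) + koszul p B (S - A - B))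
         (bracket (bracket (f A) (g B)) (h (S - A - B))))"
proof -
  let ?t = "\<lambda>A B C. sg (sum p B + koszul p A B + koszul p A C + koszul p B C) (bracket (bracket (f A) (g B)) (h C))"
  have "convolve p (convolve p f g) h S = (\<Sum>C\<in>Pow S. \<Sum>A\<in>Pow C. ?t A (C - A) (S - C))"
    unfolding convolve_def[of p "convolve p f g"]
  proof (intro sum.cong refl)
    fix C assume C: "C \<in> Pow S"
    then have fC: "finite C" using assms finite_subset by auto
    have "sg (sum p C + koszul p C (S - C)) (bracket (convolve p f g C) (h (S - C)))
      = (\<Sum>A\<in>Pow C. sg ((sum p C + koszul p C (S - C)) + (sum p A + koszul p A (C - A)))
            (bracket (bracket (f A) (g (C - A))) (h (S - C))))"
      by (simp add: convolve_def bracket_sum sg_sum bracket_sg)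
    also have "\<dots> = (\<Sum>A\<in>Pow C. ?t A (C - A) (S - C))"
    proof (intro sum.cong refl sg_cong)
      fix A assume A: "A \<in> Pow C"
      then have fA: "finite A" "finite (C - A)" using fC finite_subset by auto
      have un: "A \<union> (C - A) = C" "A \<inter> (C - A) = {}" using A by auto
      have "sum p C = sum p A + sum p (C - A)"
        using sum.union_disjoint[OF fA un(2), of p] un(1) by simp
      moreover have "koszul p C (S - C) = koszul p A (S - C) + koszul p (C - A) (S - C)"
        using crossing_Un_left[OF fA un(2)] un(1) by simp
      ultimately show "even (sum p C + koszul p C (S - C) + (sum p A + koszul p A (C - A))
          - (sum p (C - A) + koszul p A (C - A) + koszul p A (S - C) + koszul p (C - A) (S - C)))"
        by simp
    qed
    finally show "sg (sum p C + koszul p C (S - C)) (bracket (convolve p f g C) (h (S - C)))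
      = (\<Sum>A\<in>Pow C. ?t A (C - A) (S - C))" .
  qed
  then show ?thesis using sum_Pow_assoc[OF assms, of ?t] by simp
qed

text \<open>
  The double bracket is a sum over ordered partitions of \<open>S\<close> into three parts.  Rotating the parts
  does not change it, and the three rotated summands add up to zero by the Jacobi identity.
\<close>

lemma convolve_jacobi:
  assumes "finite S" and f: "\<And>A. A \<subseteq> S \<Longrightarrow> f A \<in> L (sum p A + 1)"
  shows "convolve p (convolve p f f) f S = 0"
proof -
  define t where "t = (\<lambda>A B C. sg (sum p B + koszul p A B + koszul p A C + koszul p B C)
      (bracket (bracket (f A) (f B)) (f C)))"
  let ?X = "convolve p (convolve p f f) f S"
  have 1: "?X = (\<Sum>A\<in>Pow S. \<Sum>B\<in>Pow (S - A). t A B (S - A - B))"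
    unfolding t_def by (rule convolve_convolve_left[OF assms(1)])
  have 2: "?X = (\<Sum>A\<in>Pow S. \<Sum>B\<in>Pow (S - A). t B (S - A - B) A)"
    unfolding 1 by (rule sum_Pow_rotate[OF assms(1)])
  have 3: "?X = (\<Sum>A\<in>Pow S. \<Sum>B\<in>Pow (S - A). t (S - A - B) A B)"
    unfolding 2 by (rule sum_Pow_rotate[OF assms(1), of "\<lambda>A B C. t B C A"])
  have t: "t A B C + t B C A + t C A B = 0"
    if "finite A" "finite B" "finite C" "A \<inter> B = {}" "A \<inter> C = {}" "B \<inter> C = {}" "A \<subseteq> S" "B \<subseteq> S" "C \<subseteq> S"
    for A B C
  proof -
    let ?s = "sg (sum p B + koszul p A B + koszul p A C + koszul p B C)"
    have k: "koszul p B A = sum p A * sum p B - koszul p A B" "koszul p C A = sum p A * sum p C - koszul p A C"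
      "koszul p C B = sum p B * sum p C - koszul p B C"
      using koszul_swap[of A B p] koszul_swap[of A C p] koszul_swap[of B C p] that by simp_all
    have "t A B C = ?s (bracket (bracket (f A) (f B)) (f C))" by (simp add: t_def)
    moreover have "t B C A = ?s (sg (sum p A * sum p B + sum p A * sum p C + sum p B + sum p C)
        (bracket (bracket (f B) (f C)) (f A)))"
      unfolding t_def sg_sg by (rule sg_cong) (auto simp: k)
    moreover have "t C A B = ?s (sg (sum p B * sum p C + sum p A * sum p C + sum p A + sum p B)
        (bracket (bracket (f C) (f A)) (f B)))"
      unfolding t_def sg_sg by (rule sg_cong) (auto simp: k)
    ultimately have "t A B C + t B C A + t C A B = ?s (bracket (bracket (f A) (f B)) (f C)
        + sg (sum p A * sum p B + sum p A * sum p C + sum p B + sum p C) (bracket (bracket (f B) (f C)) (f A))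
        + sg (sum p B * sum p C + sum p A * sum p C + sum p A + sum p B) (bracket (bracket (f C) (f A)) (f B)))"
      by (simp add: sg_add)
    also have "\<dots> = 0"
      using jacobi_cyclic[OF f f f] that by simp
    finally show ?thesis .
  qed
  have "t A B (S - A - B) + t B (S - A - B) A + t (S - A - B) A B = 0"
    if "A \<subseteq> S" "B \<subseteq> S - A" for A B
    by (rule t) (use that assms(1) in \<open>auto intro: finite_subset\<close>)
  then have "(\<Sum>A\<in>Pow S. \<Sum>B\<in>Pow (S - A). t A B (S - A - B) + t B (S - A - B) A + t (S - A - B) A B) = 0"
    by (intro sum.neutral ballI) auto
  then have "?X + ?X + ?X = 0"
    using 1 2 3 by (simp add: sum.distrib)
  then show ?thesis by (rule triple_eq_0)
qed

end

context homotopy_transfer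
begin


section \<open>Sums over trees solve the fixed point equation\<close>

text \<open>
  The signs are those of \<open>convolve\<close>, so that cutting a tree at its root introduces no further sign.
  The root is kept apart since \<open>f = \<eta>\<close> leads to \<open>\<Phi>\<close> and \<open>f = 1 - [d, \<eta>]\<close> to \<open>M\<close>.
\<close>

fun tree_term ::
  "(nat \<Rightarrow> int) \<Rightarrow> (nat \<Rightarrow> 'a) \<Rightarrow> ('a \<Rightarrow> 'a) \<Rightarrow> unit tree \<Rightarrow> nat list \<Rightarrow> 'a" where
  "tree_term p a f Leaf ws = a (hd ws)"
| "tree_term p a f (Node l _ r) ws =
     sg (sum p (set (take (size1 l) ws))
           + koszul p (set (take (size1 l) ws)) (set (drop (size1 l) ws)))
        (f (bracket (tree_term p a \<eta> l (take (size1 l) ws)) (tree_term p a \<eta> r (drop (size1 l) ws))))"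

abbreviation arranged_trees :: "nat set \<Rightarrow> (unit tree \<times> nat list) set" where
  "arranged_trees S \<equiv> Ot (card S) \<times> permutations_of_set S"

text \<open>
  There is one factor \<open>-1/2\<close> for each ramification.
\<close>

definition tree_sum :: "(nat \<Rightarrow> int) \<Rightarrow> (nat \<Rightarrow> 'a) \<Rightarrow> ('a \<Rightarrow> 'a) \<Rightarrow> nat set \<Rightarrow> 'a" where
  "tree_sum p a f S = (\<Sum>(\<phi>, ws)\<in>arranged_trees S.
     scale (\<iota> ((- 1 / 2) ^ (card S - 1))) (tree_term p a f \<phi> ws))"

definition Phi :: "(nat \<Rightarrow> int) \<Rightarrow> (nat \<Rightarrow> 'a) \<Rightarrow> nat set \<Rightarrow> 'a" where
  "Phi p a = tree_sum p a \<eta>"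

text \<open>
  For two or more arguments this is, by \<open>tree_sum_convolve\<close>, the sum over the trees whose root
  carries \<open>(1 - [d, \<eta>])[\<cdot>, \<cdot>]\<close>.  For fewer arguments it vanishes, in accordance with \<open>\<mu>\<^sub>1 = 0\<close>.
\<close>

definition Mu :: "(nat \<Rightarrow> int) \<Rightarrow> (nat \<Rightarrow> 'a) \<Rightarrow> nat set \<Rightarrow> 'a" where
  "Mu p a S = - half (proj (convolve p (Phi p a) (Phi p a) S))"

text \<open>
  A tree with at least two leaves together with an arrangement of \<open>S\<close> is the same thing as a
  subset \<open>A\<close> of \<open>S\<close> and arranged trees for \<open>A\<close> and for its complement.  Trees have at least one
  leaf, so empty parts contribute nothing.
\<close>

lemma sum_arranged_trees_split:
  assumes "finite S" "2 \<le> card S"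
  shows "(\<Sum>x\<in>arranged_trees S. G x)
       = (\<Sum>A\<in>Pow S. \<Sum>x\<in>arranged_trees A. \<Sum>y\<in>arranged_trees (S - A).
            G (Node (fst x) () (fst y), snd x @ snd y))"
proof -
  let ?Q = "Sigma (Pow S) (\<lambda>A. arranged_trees A \<times> arranged_trees (S - A))"
  let ?glue = "\<lambda>(A :: nat set, x :: unit tree \<times> nat list, y). (Node (fst x) () (fst y), snd x @ snd y)"
  let ?cut = "\<lambda>(\<phi>, ws). case \<phi> of Leaf \<Rightarrow> undefined
      | Node l (_ :: unit) r \<Rightarrow> (set (take (size1 l) ws), (l, take (size1 l) ws), (r, drop (size1 l) ws))"
  have fin: "finite A" if "A \<subseteq> S" for A using that assms(1) by (rule finite_subset)
  have cut: "?glue (?cut x) = x \<and> ?cut x \<in> ?Q" if x: "x \<in> arranged_trees S" for x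
  proof -
    obtain \<phi> ws where x_eq: "x = (\<phi>, ws)" and \<phi>: "size1 \<phi> = card S" and ws: "set ws = S" "distinct ws"
      using x by (auto simp: Ot_def permutations_of_set_def)
    have len: "length ws = card S" using distinct_card[OF ws(2)] ws(1) by simp
    obtain l r where \<phi>_eq: "\<phi> = Node l () r"
      using \<phi> assms(2) by (cases \<phi>) auto
    let ?u = "take (size1 l) ws" and ?v = "drop (size1 l) ws"
    have "set ?u \<union> set ?v = S" using ws(1) by (simp flip: set_append)
    moreover have "set ?u \<inter> set ?v = {}" using ws(2) by (simp add: set_take_disj_set_drop_if_distinct)
    ultimately have "S - set ?u = set ?v" "set ?u \<subseteq> S" by auto
    moreover have "distinct ?u" "distinct ?v" using ws(2) by simp_all
    moreover have "length ?u = size1 l" "length ?v = size1 r" using \<phi> len by (simp_all add: \<phi>_eq)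
    ultimately show ?thesis
      by (auto simp: x_eq \<phi>_eq Ot_def permutations_of_set_def distinct_card)
  qed
  have glue: "?cut (?glue y) = y \<and> ?glue y \<in> arranged_trees S" if y: "y \<in> ?Q" for y
  proof -
    obtain A l u r v where y_eq: "y = (A, (l, u), (r, v))" and A: "A \<subseteq> S"
      and l: "size1 l = card A" and u: "set u = A" "distinct u"
      and r: "size1 r = card (S - A)" and v: "set v = S - A" "distinct v"
      using y by (auto simp: Ot_def permutations_of_set_def)
    have "length u = size1 l" using distinct_card[OF u(2)] u(1) l by simp
    moreover have "card A + card (S - A) = card S"
      using A fin[OF A] assms(1) by (simp add: card_Diff_subset card_mono)
    ultimately show ?thesis
      using A l u r v by (auto simp: y_eq Ot_def permutations_of_set_def)
  qed
  have "(\<Sum>x\<in>arranged_trees S. G x) = (\<Sum>y\<in>?Q. G (?glue y))"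
    by (rule sum.reindex_bij_witness[of _ ?glue ?cut]) (use cut glue in auto)
  also have "\<dots> = (\<Sum>A\<in>Pow S. \<Sum>(x, y)\<in>arranged_trees A \<times> arranged_trees (S - A).
            G (Node (fst x) () (fst y), snd x @ snd y))"
    by (subst sum.Sigma) (use assms(1) fin in \<open>auto simp: finite_Ot case_prod_unfold intro!: sum.cong\<close>)
  also have "\<dots> = (\<Sum>A\<in>Pow S. \<Sum>x\<in>arranged_trees A. \<Sum>y\<in>arranged_trees (S - A).
            G (Node (fst x) () (fst y), snd x @ snd y))"
    by (simp only: sum.cartesian_product)
  finally show ?thesis .
qed

text \<open>
  Cutting every tree at its root gives the recursion that defines the formal solution of
  \<open>\<Phi> = x - 1/2 \<eta>[\<Phi>, \<Phi>]\<close> when \<open>f = \<eta>\<close>.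
\<close>

lemma tree_sum_convolve:
  assumes "finite S" "2 \<le> card S" and f: "module_hom scale scale f"
  shows "tree_sum p a f S = - half (f (convolve p (Phi p a) (Phi p a) S))"
proof -
  let ?c = "\<lambda>n. \<iota> ((- 1 / 2) ^ (n - 1))"
  let ?t = "\<lambda>A x. scale (?c (card A)) (tree_term p a \<eta> (fst x) (snd x))"
  let ?e = "\<lambda>A. sum p A + koszul p A (S - A)"
  have summand: "scale (?c (card S)) (tree_term p a f (Node (fst x) () (fst y)) (snd x @ snd y))
      = - half (f (sg (?e A) (bracket (?t A x) (?t (S - A) y))))"
    if A: "A \<subseteq> S" and x: "x \<in> arranged_trees A" and y: "y \<in> arranged_trees (S - A)" for A x y
  proof -
    obtain l u where xl: "x = (l, u)" "size1 l = card A" "set u = A" "distinct u"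
      using x by (auto simp: Ot_def permutations_of_set_def)
    obtain r v where yr: "y = (r, v)" "size1 r = card (S - A)" "set v = S - A" "distinct v"
      using y by (auto simp: Ot_def permutations_of_set_def)
    have len: "length u = size1 l" using distinct_card[OF xl(4)] xl by simp
    have pos: "0 < card A" "0 < card (S - A)" using xl(2) yr(2) by (metis size1_size zero_less_Suc Suc_eq_plus1)+
    have "card A + card (S - A) = card S"
      using A assms(1) by (simp add: card_Diff_subset card_mono finite_subset)
    then have "card S - 1 = Suc ((card A - 1) + (card (S - A) - 1))" using pos by linarith
    then have "?c (card S) = - \<iota> (1 / 2) * (?c (card A) * ?c (card (S - A)))"
      by (simp only: power_Suc power_add iota_mult flip: iota_minus minus_divide_left)
    moreover have "tree_term p a f (Node l () r) (u @ v)
        = sg (?e A) (f (bracket (tree_term p a \<eta> l u) (tree_term p a \<eta> r v)))"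
      using xl yr len by simp
    ultimately show ?thesis
      by (simp add: xl yr half_def bracket_scale module_hom.scale[OF f] hom_sg[OF f]
          hom_sg[OF module_hom_scale_self] scale_minus_left sg_minus ac_simps)
  qed
  have "tree_sum p a f S = (\<Sum>x\<in>arranged_trees S. scale (?c (card S)) (tree_term p a f (fst x) (snd x)))"
    by (simp add: tree_sum_def case_prod_unfold)
  also have "\<dots> = (\<Sum>A\<in>Pow S. \<Sum>x\<in>arranged_trees A. \<Sum>y\<in>arranged_trees (S - A).
       scale (?c (card S)) (tree_term p a f (Node (fst x) () (fst y)) (snd x @ snd y)))"
    by (subst sum_arranged_trees_split[OF assms(1,2)]) simp
  also have "\<dots> = (\<Sum>A\<in>Pow S. \<Sum>x\<in>arranged_trees A. \<Sum>y\<in>arranged_trees (S - A).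
       - half (f (sg (?e A) (bracket (?t A x) (?t (S - A) y)))))"
    by (intro sum.cong refl summand) auto
  also have "\<dots> = - half (f (\<Sum>A\<in>Pow S. \<Sum>x\<in>arranged_trees A. \<Sum>y\<in>arranged_trees (S - A).
       sg (?e A) (bracket (?t A x) (?t (S - A) y))))"
    by (simp only: module_hom.sum[OF half_linear] module_hom.sum[OF f] sum_negf)
  also have "(\<Sum>A\<in>Pow S. \<Sum>x\<in>arranged_trees A. \<Sum>y\<in>arranged_trees (S - A).
       sg (?e A) (bracket (?t A x) (?t (S - A) y)))
      = (\<Sum>A\<in>Pow S. sg (?e A) (bracket (\<Sum>x\<in>arranged_trees A. ?t A x) (\<Sum>y\<in>arranged_trees (S - A). ?t (S - A) y)))"
    by (simp only: bracket_sum(1) sg_sum) (simp only: bracket_sum(2) sg_sum)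
  also have "\<dots> = convolve p (Phi p a) (Phi p a) S"
    by (simp add: convolve_def Phi_def tree_sum_def case_prod_unfold)
  finally show ?thesis .
qed

lemma Phi_empty [simp]: "Phi p a {} = 0"
  by (simp add: Phi_def tree_sum_def Ot_def size1_size)

lemma Phi_singleton [simp]: "Phi p a {i} = a i"
proof -
  have "Ot 1 = {Leaf}"
  proof (intro set_eqI)
    fix t :: "unit tree" show "t \<in> Ot 1 \<longleftrightarrow> t \<in> {Leaf}" by (cases t) (auto simp: Ot_def size1_size)
  qed
  moreover have "permutations_of_set {i} = {[i]}"
    by (auto simp: permutations_of_set_def) (metis distinct_singleton set_empty insert_not_empty distinct_length_2_or_more list.set_intros(1) list.set_intros(2) neq_Nil_conv singletonD)
  ultimately show ?thesis by (simp add: Phi_def tree_sum_def iota_1)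
qed

lemma Phi_rec:
  assumes "finite S" "2 \<le> card S"
  shows "Phi p a S = - half (\<eta> (convolve p (Phi p a) (Phi p a) S))"
  unfolding Phi_def[of p a] using tree_sum_convolve[OF assms \<eta>_linear] by (simp add: Phi_def)

lemma finite_size_cases [consumes 1, case_names empty single large]:
  assumes "finite S"
  obtains "S = {}" | i where "S = {i}" | "2 \<le> card S"
proof -
  consider "card S = 0" | "card S = 1" | "2 \<le> card S" by linarith
  then show thesis using assms that by cases (auto simp: card_1_singleton_iff)
qed

text \<open>
  Functions vanishing at the empty set pair their value at \<open>S\<close> with zero.  Thus the right-hand side
  of a fixed point equation depends on smaller sets only, which makes induction on \<open>S\<close> possible.
\<close>

lemma convolve_cong_proper:
  assumes "\<And>A. A \<subset> S \<Longrightarrow> f A = f' A" "\<And>A. A \<subset> S \<Longrightarrow> g A = g' A"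
    and "f {} = 0" "f' {} = 0" "g {} = 0" "g' {} = 0" and "\<And>i. i \<in> S \<Longrightarrow> p i = q i"
  shows "convolve p f g S = convolve q f' g' S"
  unfolding convolve_def
proof (intro sum.cong refl)
  fix A assume A: "A \<in> Pow S"
  have e: "sum p A = sum q A" "koszul p A (S - A) = koszul q A (S - A)"
    using A assms(7) by (auto intro!: sum.cong koszul_cong)
  consider "A = {}" | "A = S" | "A \<subset> S" "S - A \<subset> S" using A by blast
  then show "sg (sum p A + koszul p A (S - A)) (bracket (f A) (g (S - A)))
      = sg (sum q A + koszul q A (S - A)) (bracket (f' A) (g' (S - A)))"
    unfolding e by cases (simp_all add: assms bracket_0)
qed

lemma convolve_small:
  assumes "f {} = 0" "g {} = 0"
  shows "convolve p f g {} = 0" "convolve p f g {i} = 0"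
proof -
  have "convolve p f g {} = convolve p (\<lambda>A. 0) (\<lambda>A. 0) {}"
    "convolve p f g {i} = convolve p (\<lambda>A. 0) (\<lambda>A. 0) {i}"
    using assms by (auto intro!: convolve_cong_proper simp: psubset_eq subset_singleton_iff)
  then show "convolve p f g {} = 0" "convolve p f g {i} = 0"
    by (simp_all add: convolve_def bracket_0)
qed

lemma Phi_cong:
  assumes "finite S" "\<And>i. i \<in> S \<Longrightarrow> p i = q i" "\<And>i. i \<in> S \<Longrightarrow> a i = b i"
  shows "Phi p a S = Phi q b S"
  using assms
proof (induction S rule: finite_psubset_induct)
  case (psubset S)
  show ?case
  proof (cases rule: finite_size_cases[OF psubset.hyps(1)])
    case 3
    have "convolve p (Phi p a) (Phi p a) S = convolve q (Phi q b) (Phi q b) S"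
      by (rule convolve_cong_proper) (use psubset in \<open>auto intro!: psubset.IH\<close>)
    then show ?thesis using 3 psubset.hyps(1) by (simp add: Phi_rec)
  qed (use psubset.prems in auto)
qed

lemma Phi_degree:
  assumes "finite S" "\<And>i. i \<in> S \<Longrightarrow> a i \<in> L (p i + 1)"
  shows "Phi p a S \<in> L (sum p S + 1)"
  using assms
proof (induction S rule: finite_psubset_induct)
  case (psubset S)
  show ?case
  proof (cases rule: finite_size_cases[OF psubset.hyps(1)])
    case 3
    \<comment> \<open>the value of \<open>Phi\<close> at \<open>S\<close>, whose degree is to be found, is paired with \<open>Phi {} = 0\<close>\<close>
    let ?f = "\<lambda>A. if A \<subset> S then Phi p a A else 0"
    have "convolve p (Phi p a) (Phi p a) S = convolve p ?f ?f S"
      by (rule convolve_cong_proper) auto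
    also have "\<dots> \<in> L (sum p S + (1 + 1))"
      using psubset by (intro convolve_degree) (auto simp: L_0)
    finally have "\<eta> (convolve p (Phi p a) (Phi p a) S) \<in> L (sum p S + 1)"
      by (rule L_cast[OF \<eta>_degree]) simp
    then show ?thesis using 3 psubset.hyps(1) by (simp add: Phi_rec half_def L_neg L_scale)
  qed (use psubset.prems in \<open>auto simp: L_0\<close>)
qed

lemma Mu_degree:
  assumes "finite S" "\<And>i. i \<in> S \<Longrightarrow> a i \<in> L (p i + 1)"
  shows "Mu p a S \<in> L (sum p S + 2)"
proof -
  have "convolve p (Phi p a) (Phi p a) S \<in> L (sum p S + (1 + 1))"
    by (rule convolve_degree[OF assms(1)]; rule Phi_degree) (use assms in \<open>auto intro: finite_subset\<close>)
  then show ?thesis by (simp add: Mu_def half_def L_neg L_scale proj_degree)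
qed

lemma Mu_small: "Mu p a {} = 0" "Mu p a {i} = 0"
  by (simp_all add: Mu_def convolve_small half_simps module_hom.zero[OF proj_linear])

lemma convolve_eq_0:
  assumes "i \<in> S" "\<And>A. A \<subset> S \<Longrightarrow> i \<in> A \<Longrightarrow> f A = 0" "f {} = 0"
  shows "convolve p f f S = 0"
proof -
  have "bracket (f A) (f (S - A)) = 0" if "A \<in> Pow S" for A
  proof -
    have "f A = 0 \<or> f (S - A) = 0"
    proof (cases "A = {} \<or> A = S")
      case False
      then have "A \<subset> S" "S - A \<subset> S" using that by auto
      then show ?thesis using assms(1) assms(2)[of A] assms(2)[of "S - A"] by (cases "i \<in> A") auto
    qed (use assms(3) in auto)
    then show ?thesis by (auto simp: bracket_0)
  qed
  then show ?thesis by (simp add: convolve_def)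
qed

lemma Phi_eq_0:
  assumes "finite S" "i \<in> S" "a i = 0"
  shows "Phi p a S = 0"
  using assms
proof (induction S rule: finite_psubset_induct)
  case (psubset S)
  show ?case
  proof (cases rule: finite_size_cases[OF psubset.hyps(1)])
    case 3
    have "convolve p (Phi p a) (Phi p a) S = 0"
      using psubset by (intro convolve_eq_0) auto
    then show ?thesis using 3 psubset.hyps(1) by (simp add: Phi_rec \<eta>_simps half_simps)
  qed (use psubset.prems in auto)
qed

lemma Mu_eq_0:
  assumes "finite S" "i \<in> S" "a i = 0"
  shows "Mu p a S = 0"
proof -
  have "convolve p (Phi p a) (Phi p a) S = 0"
    by (rule convolve_eq_0[OF assms(2)]) (use assms in \<open>auto intro!: Phi_eq_0 intro: finite_subset\<close>)
  then show ?thesis by (simp add: Mu_def module_hom.zero[OF proj_linear] half_simps)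
qed


section \<open>The curvature of the solution\<close>

lemma d_Phi:
  assumes "finite S" "\<And>i. i \<in> S \<Longrightarrow> d (a i) = 0"
  shows "d (Phi p a S) = - half (d (\<eta> (convolve p (Phi p a) (Phi p a) S)))"
proof (cases rule: finite_size_cases[OF assms(1)])
  case 3
  then show ?thesis using assms(1) by (simp add: Phi_rec half_def d_simps)
qed (use assms in \<open>auto simp: convolve_small d_simps \<eta>_simps half_simps\<close>)

definition curvature :: "(nat \<Rightarrow> int) \<Rightarrow> (nat \<Rightarrow> 'a) \<Rightarrow> nat set \<Rightarrow> 'a" where
  "curvature p a S = d (Phi p a S) + half (convolve p (Phi p a) (Phi p a) S)"

text \<open>
  \<open>[F, \<Phi>] = [d\<Phi>, \<Phi>] + 1/2 [[\<Phi>, \<Phi>], \<Phi>]\<close>; the last term vanishes by the Jacobi identity, and the first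
  is half of \<open>d[\<Phi>, \<Phi>]\<close> by the Leibniz rule.
\<close>

lemma convolve_curvature:
  assumes "finite S" "\<And>i. i \<in> S \<Longrightarrow> a i \<in> L (p i + 1)"
  shows "convolve p (curvature p a) (Phi p a) S = half (d (convolve p (Phi p a) (Phi p a) S))"
proof -
  have deg: "Phi p a A \<in> L (sum p A + 1)" if "A \<subseteq> S" for A
    using that assms by (intro Phi_degree) (auto intro: finite_subset)
  have "convolve p (curvature p a) (Phi p a) S = convolve p (\<lambda>A. d (Phi p a A)) (Phi p a) S
      + half (convolve p (convolve p (Phi p a) (Phi p a)) (Phi p a) S)"
    unfolding curvature_def convolve_add_left convolve_half_left ..
  also have "\<dots> = convolve p (\<lambda>A. d (Phi p a A)) (Phi p a) S"
    using convolve_jacobi[OF assms(1) deg] by (simp add: half_simps)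
  also have "\<dots> = half (d (convolve p (Phi p a) (Phi p a) S))"
    using d_convolve[OF assms(1) deg] by (simp add: half_double)
  finally show ?thesis .
qed

text \<open>
  Since \<open>dx = 0\<close>, \<open>F = 1/2 (1 - d\<eta>)[\<Phi>, \<Phi>] = 1/2 (1 - [d, \<eta>])[\<Phi>, \<Phi>] + 1/2 \<eta>d[\<Phi>, \<Phi>]\<close>.
\<close>

lemma curvature_rec:
  assumes "finite S" "\<And>i. i \<in> S \<Longrightarrow> a i \<in> L (p i + 1)" "\<And>i. i \<in> S \<Longrightarrow> d (a i) = 0"
  shows "curvature p a S = - Mu p a S + \<eta> (convolve p (curvature p a) (Phi p a) S)"
proof -
  let ?B = "convolve p (Phi p a) (Phi p a) S"
  have "curvature p a S = half ?B - half (d (\<eta> ?B))"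
    using d_Phi[of S a p] assms by (simp add: curvature_def)
  also have "\<dots> = half (proj ?B) + half (\<eta> (d ?B))"
    by (simp add: proj_def comm_op_def half_simps)
  also have "half (\<eta> (d ?B)) = \<eta> (half (d ?B))" by (simp add: half_def \<eta>_simps)
  also have "half (d ?B) = convolve p (curvature p a) (Phi p a) S"
    using convolve_curvature[OF assms(1,2)] by simp
  finally show ?thesis by (simp add: Mu_def)
qed

lemma proj_convolve_curvature:
  assumes "finite S" "\<And>i. i \<in> S \<Longrightarrow> a i \<in> L (p i + 1)"
  shows "proj (convolve p (curvature p a) (Phi p a) S) = 0"
proof -
  have "proj (half (d x)) = 0" for x
    using proj_d by (simp add: half_def module_hom.scale[OF proj_linear])
  then show ?thesis using convolve_curvature[OF assms] by simp
qed


section \<open>Differentiating the solution along the transferred operations\<close>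

text \<open>
  The bracket of the derivative of \<open>\<Phi>\<close> in direction \<open>u\<close> with \<open>\<Phi>\<close>.  The new argument \<open>u\<close>, of shifted
  degree \<open>q\<close>, is placed at the index \<open>0\<close>, in front of all the others, which have positive indices.
\<close>

definition pointed_convolve :: "(nat \<Rightarrow> int) \<Rightarrow> (nat \<Rightarrow> 'a) \<Rightarrow> int \<Rightarrow> 'a \<Rightarrow> nat set \<Rightarrow> 'a" where
  "pointed_convolve p a q u B = (\<Sum>C\<in>Pow B. sg (q + sum p C + koszul p C (B - C))
     (bracket (Phi (p(0 := q)) (a(0 := u)) (insert 0 C)) (Phi p a (B - C))))"

text \<open>
  The bracket \<open>[\<Phi>, \<Phi>]\<close> is symmetric, so differentiating it in direction \<open>u\<close> gives twice the bracket of
  the derivative of \<open>\<Phi>\<close> with \<open>\<Phi>\<close>: the index \<open>0\<close> lies in the left or in the right part, and both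
  cases contribute the same.
\<close>

lemma convolve_insert_0:
  assumes B: "finite B" "0 \<notin> B" and a: "\<And>i. i \<in> B \<Longrightarrow> a i \<in> L (p i + 1)" and u: "u \<in> L (q + 1)"
    and p'_def: "p' = p(0 := q)" and a'_def: "a' = a(0 := u)"
  shows "convolve p' (Phi p' a') (Phi p' a') (insert 0 B) = pointed_convolve p a q u B + pointed_convolve p a q u B"
proof -
  let ?t = "\<lambda>A D. sg (sum p' A + koszul p' A D) (bracket (Phi p' a' A) (Phi p' a' D))"
  have a': "a' i \<in> L (p' i + 1)" if "i \<in> insert 0 B" for i
    using that a u by (auto simp: p'_def a'_def)
  have fin: "finite C" if "C \<subseteq> B" for C using that B(1) by (rule finite_subset)
  have X: "(\<Sum>C\<in>Pow B. ?t (insert 0 C) (B - C)) = pointed_convolve p a q u B"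
    unfolding pointed_convolve_def
  proof (intro sum.cong refl)
    fix C assume C: "C \<in> Pow B"
    then have C0: "finite C" "0 \<notin> C" using B fin by auto
    have ne: "i \<noteq> 0" if "i \<in> B" for i using that B(2) by metis
    have "sum p' C = sum p C" using C ne by (intro sum.cong) (auto simp: p'_def)
    then have "sum p' (insert 0 C) = q + sum p C" using C0 by (simp add: p'_def)
    moreover have "koszul p' {0} (B - C) = 0" by (simp add: crossing_def)
    then have "koszul p' (insert 0 C) (B - C) = koszul p' C (B - C)"
      using crossing_Un_left[of "{0}" C _ "B - C"] C0 by simp
    moreover have "koszul p' C (B - C) = koszul p C (B - C)"
      using C ne by (intro koszul_cong) (auto simp: p'_def)
    moreover have "Phi p' a' (B - C) = Phi p a (B - C)"
      using B(1) ne by (intro Phi_cong) (auto simp: p'_def a'_def)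
    ultimately show "?t (insert 0 C) (B - C) = sg (q + sum p C + koszul p C (B - C))
       (bracket (Phi (p(0 := q)) (a(0 := u)) (insert 0 C)) (Phi p a (B - C)))"
      by (simp add: p'_def a'_def)
  qed
  have "convolve p' (Phi p' a') (Phi p' a') (insert 0 B)
      = (\<Sum>C\<in>Pow B. ?t C (insert 0 B - C)) + (\<Sum>C\<in>Pow B. ?t (insert 0 C) (insert 0 B - insert 0 C))"
    unfolding convolve_def by (rule sum_Pow_insert[OF B])
  also have "(\<Sum>C\<in>Pow B. ?t (insert 0 C) (insert 0 B - insert 0 C)) = (\<Sum>C\<in>Pow B. ?t (insert 0 C) (B - C))"
    using B(2) by (intro sum.cong refl arg_cong2[of _ _ _ _ ?t]) auto
  also have "(\<Sum>C\<in>Pow B. ?t C (insert 0 B - C)) = (\<Sum>C\<in>Pow B. ?t C (insert 0 (B - C)))"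
    using B(2) by (intro sum.cong refl arg_cong2[of _ _ _ _ ?t]) auto
  also have "\<dots> = (\<Sum>C\<in>Pow B. ?t (B - C) (insert 0 C))"
    by (rule sum_Pow_complement[OF B(1), of "\<lambda>A D. ?t A (insert 0 D)"])
  also have "\<dots> = (\<Sum>C\<in>Pow B. ?t (insert 0 C) (B - C))"
  proof (intro sum.cong refl convolve_term_swap)
    fix C assume "C \<in> Pow B"
    then show "finite (B - C)" "finite (insert 0 C)" "(B - C) \<inter> insert 0 C = {}"
      "Phi p' a' (B - C) \<in> L (sum p' (B - C) + 1)" "Phi p' a' (insert 0 C) \<in> L (sum p' (insert 0 C) + 1)"
      using B fin a' by (auto intro!: Phi_degree)
  qed
  finally show ?thesis unfolding X .
qed

lemma pointed_convolve_empty: "pointed_convolve p a q u {} = 0"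
  by (simp add: pointed_convolve_def bracket_0)

lemma Phi_insert_0:
  assumes B: "finite B" "0 \<notin> B" and a: "\<And>i. i \<in> B \<Longrightarrow> a i \<in> L (p i + 1)" and u: "u \<in> L (q + 1)"
  shows "Phi (p(0 := q)) (a(0 := u)) (insert 0 B) = (if B = {} then u else 0) - \<eta> (pointed_convolve p a q u B)"
proof (cases "B = {}")
  case False
  then have "0 < card B" using B(1) by (simp add: card_gt_0_iff)
  then have "2 \<le> card (insert 0 B)" using B by simp
  then show ?thesis
    using False B(1) convolve_insert_0[OF assms refl refl]
    by (simp add: Phi_rec \<eta>_simps half_simps(1)[symmetric] half_double)
qed (simp add: pointed_convolve_empty \<eta>_simps)

lemma Mu_insert_0:
  assumes B: "finite B" "0 \<notin> B" and a: "\<And>i. i \<in> B \<Longrightarrow> a i \<in> L (p i + 1)" and u: "u \<in> L (q + 1)"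
  shows "Mu (p(0 := q)) (a(0 := u)) (insert 0 B) = - proj (pointed_convolve p a q u B)"
proof -
  have "convolve (p(0 := q)) (Phi (p(0 := q)) (a(0 := u))) (Phi (p(0 := q)) (a(0 := u))) (insert 0 B)
      = pointed_convolve p a q u B + pointed_convolve p a q u B"
    by (rule convolve_insert_0[OF assms refl refl])
  then show ?thesis by (simp only: Mu_def module_hom.add[OF proj_linear] half_double)
qed

text \<open>
  The derivative \<open>\<Psi>\<close> of \<open>\<Phi>\<close> in the direction of \<open>M\<close>, which has total degree \<open>2\<close>: the coefficient
  \<open>M A\<close> is inserted in front of the arguments in \<open>S - A\<close> and has shifted degree \<open>sum p A + 1\<close>.
\<close>

definition dPhi_Mu :: "(nat \<Rightarrow> int) \<Rightarrow> (nat \<Rightarrow> 'a) \<Rightarrow> nat set \<Rightarrow> 'a" where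
  "dPhi_Mu p a S = (\<Sum>A\<in>Pow S. sg (koszul p A (S - A))
     (Phi (p(0 := sum p A + 1)) (a(0 := Mu p a A)) (insert 0 (S - A))))"

text \<open>
  Both sides run over partitions of \<open>S\<close> into the arguments of \<open>M\<close>, the remaining arguments of the
  derivative of \<open>\<Phi>\<close>, and the arguments of \<open>\<Phi>\<close>.  The minus sign comes from the shifted degree
  \<open>sum p A + 1\<close> of \<open>M A\<close>, which exceeds that of its arguments by one.
\<close>

lemma sum_pointed_convolve_Mu:
  assumes "finite S"
  shows "(\<Sum>A\<in>Pow S. sg (koszul p A (S - A)) (pointed_convolve p a (sum p A + 1) (Mu p a A) (S - A)))
       = - convolve p (dPhi_Mu p a) (Phi p a) S"
proof -
  let ?P = "\<lambda>A B. Phi (p(0 := sum p A + 1)) (a(0 := Mu p a A)) (insert 0 B)"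
  let ?t = "\<lambda>A B C. sg (sum p A + sum p B + koszul p A B + koszul p A C + koszul p B C)
      (bracket (?P A B) (Phi p a C))"
  have "convolve p (dPhi_Mu p a) (Phi p a) S = (\<Sum>C\<in>Pow S. \<Sum>A\<in>Pow C. ?t A (C - A) (S - C))"
    unfolding convolve_def
  proof (intro sum.cong refl)
    fix C assume C: "C \<in> Pow S"
    then have fC: "finite C" using assms finite_subset by auto
    have "sg (sum p C + koszul p C (S - C)) (bracket (dPhi_Mu p a C) (Phi p a (S - C)))
      = (\<Sum>A\<in>Pow C. sg ((sum p C + koszul p C (S - C)) + koszul p A (C - A))
            (bracket (?P A (C - A)) (Phi p a (S - C))))"
      by (simp add: dPhi_Mu_def bracket_sum sg_sum bracket_sg)
    also have "\<dots> = (\<Sum>A\<in>Pow C. ?t A (C - A) (S - C))"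
    proof (intro sum.cong refl sg_cong)
      fix A assume A: "A \<in> Pow C"
      then have fA: "finite A" "finite (C - A)" using fC finite_subset by auto
      have un: "A \<union> (C - A) = C" "A \<inter> (C - A) = {}" using A by auto
      have "sum p C = sum p A + sum p (C - A)"
        using sum.union_disjoint[OF fA un(2), of p] un(1) by simp
      moreover have "koszul p C (S - C) = koszul p A (S - C) + koszul p (C - A) (S - C)"
        using crossing_Un_left[OF fA un(2)] un(1) by simp
      ultimately show "even (sum p C + koszul p C (S - C) + koszul p A (C - A)
          - (sum p A + sum p (C - A) + koszul p A (C - A) + koszul p A (S - C) + koszul p (C - A) (S - C)))"
        by simp
    qed
    finally show "sg (sum p C + koszul p C (S - C)) (bracket (dPhi_Mu p a C) (Phi p a (S - C)))
      = (\<Sum>A\<in>Pow C. ?t A (C - A) (S - C))" .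
  qed
  also have "\<dots> = (\<Sum>A\<in>Pow S. \<Sum>B\<in>Pow (S - A). ?t A B (S - A - B))"
    by (rule sum_Pow_assoc[OF assms])
  also have "\<dots> = (\<Sum>A\<in>Pow S. - sg (koszul p A (S - A)) (pointed_convolve p a (sum p A + 1) (Mu p a A) (S - A)))"
  proof (intro sum.cong refl)
    fix A assume A: "A \<in> Pow S"
    have "- sg (koszul p A (S - A)) (pointed_convolve p a (sum p A + 1) (Mu p a A) (S - A))
      = (\<Sum>B\<in>Pow (S - A). sg (1 + (koszul p A (S - A) + (sum p A + 1 + sum p B + koszul p B (S - A - B))))
           (bracket (?P A B) (Phi p a (S - A - B))))"
      by (simp only: pointed_convolve_def sg_sum sg_sg sg_one_plus sum_negf)
    also have "\<dots> = (\<Sum>B\<in>Pow (S - A). ?t A B (S - A - B))"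
    proof (intro sum.cong refl sg_cong)
      fix B assume B: "B \<in> Pow (S - A)"
      then have "finite B" "B \<union> (S - A - B) = S - A"
        using assms by (auto intro: finite_subset)
      then have "koszul p A (S - A) = koszul p A B + koszul p A (S - A - B)"
        using assms crossing_Un_right[of B "S - A - B" _ A] by simp
      then show "even (1 + (koszul p A (S - A) + (sum p A + 1 + sum p B + koszul p B (S - A - B)))
         - (sum p A + sum p B + koszul p A B + koszul p A (S - A - B) + koszul p B (S - A - B)))"
        by simp
    qed
    finally show "(\<Sum>B\<in>Pow (S - A). ?t A B (S - A - B))
       = - sg (koszul p A (S - A)) (pointed_convolve p a (sum p A + 1) (Mu p a A) (S - A))" ..
  qed
  finally show ?thesis by (simp add: sum_negf)
qed

lemma dPhi_Mu_rec:
  assumes S: "finite S" "0 \<notin> S" and a: "\<And>i. i \<in> S \<Longrightarrow> a i \<in> L (p i + 1)"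
  shows "dPhi_Mu p a S = Mu p a S + \<eta> (convolve p (dPhi_Mu p a) (Phi p a) S)"
proof -
  let ?X = "\<lambda>A. pointed_convolve p a (sum p A + 1) (Mu p a A) (S - A)"
  have "dPhi_Mu p a S = (\<Sum>A\<in>Pow S. (if A = S then Mu p a A else 0) - sg (koszul p A (S - A)) (\<eta> (?X A)))"
    unfolding dPhi_Mu_def
  proof (intro sum.cong refl)
    fix A assume A: "A \<in> Pow S"
    then have fA: "finite A" using S(1) finite_subset by auto
    have "Mu p a A \<in> L ((sum p A + 1) + 1)"
      using Mu_degree[OF fA, of a p] A a by (auto simp: add.assoc)
    then have "Phi (p(0 := sum p A + 1)) (a(0 := Mu p a A)) (insert 0 (S - A))
       = (if S - A = {} then Mu p a A else 0) - \<eta> (?X A)"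
      using S a by (intro Phi_insert_0) auto
    moreover have "S - A = {} \<longleftrightarrow> A = S" using A by auto
    ultimately show "sg (koszul p A (S - A)) (Phi (p(0 := sum p A + 1)) (a(0 := Mu p a A)) (insert 0 (S - A)))
        = (if A = S then Mu p a A else 0) - sg (koszul p A (S - A)) (\<eta> (?X A))"
      by (auto simp: sg_minus pointed_convolve_empty \<eta>_simps)
  qed
  also have "\<dots> = Mu p a S - \<eta> (\<Sum>A\<in>Pow S. sg (koszul p A (S - A)) (?X A))"
    using S(1) by (simp add: sum_subtractf module_hom.sum[OF \<eta>_linear] hom_sg[OF \<eta>_linear] sum.delta)
  finally show ?thesis by (simp add: sum_pointed_convolve_Mu[OF S(1)] \<eta>_simps)
qed

text \<open>
  \<open>\<Psi>\<close> and \<open>- F\<close> are solutions of the same fixed point equation, and it has only one.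
\<close>

lemma dPhi_Mu_eq_curvature:
  assumes "finite S" "0 \<notin> S" "\<And>i. i \<in> S \<Longrightarrow> a i \<in> L (p i + 1)" "\<And>i. i \<in> S \<Longrightarrow> d (a i) = 0"
  shows "dPhi_Mu p a S = - curvature p a S"
  using assms
proof (induction S rule: finite_psubset_induct)
  case (psubset S)
  have curvature_empty: "curvature p a {} = 0" by (simp add: curvature_def d_simps convolve_small half_simps)
  have dPhi_empty: "dPhi_Mu p a {} = 0"
    by (simp add: dPhi_Mu_def Mu_small)
  have "convolve p (dPhi_Mu p a) (Phi p a) S = convolve p (\<lambda>A. - curvature p a A) (Phi p a) S"
    by (rule convolve_cong_proper)
       (use psubset.prems in \<open>auto intro!: psubset.IH simp: curvature_empty dPhi_empty\<close>)
  then have "dPhi_Mu p a S = Mu p a S - \<eta> (convolve p (curvature p a) (Phi p a) S)"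
    using dPhi_Mu_rec[of S a p] psubset by (simp add: convolve_neg_left \<eta>_simps)
  also have "\<dots> = - curvature p a S"
    using curvature_rec[of S a p] psubset by simp
  finally show ?case .
qed

text \<open>
  The sum is the derivative of \<open>M\<close> in the direction \<open>M\<close>, that is \<open>(1 - [d, \<eta>])[\<Psi>, \<Phi>]\<close>.  Since \<open>\<Psi> = - F\<close>
  and \<open>[F, \<Phi>]\<close> is a boundary, the projection kills it.
\<close>

lemma Mu_identity:
  assumes S: "finite S" "0 \<notin> S" and a: "\<And>i. i \<in> S \<Longrightarrow> a i \<in> L (p i + 1)" "\<And>i. i \<in> S \<Longrightarrow> d (a i) = 0"
  shows "(\<Sum>A\<in>Pow S. sg (koszul p A (S - A))
     (Mu (p(0 := sum p A + 1)) (a(0 := Mu p a A)) (insert 0 (S - A)))) = 0"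
proof -
  let ?X = "\<lambda>A. pointed_convolve p a (sum p A + 1) (Mu p a A) (S - A)"
  have "(\<Sum>A\<in>Pow S. sg (koszul p A (S - A))
      (Mu (p(0 := sum p A + 1)) (a(0 := Mu p a A)) (insert 0 (S - A))))
      = (\<Sum>A\<in>Pow S. - sg (koszul p A (S - A)) (proj (?X A)))"
  proof (intro sum.cong refl)
    fix A assume A: "A \<in> Pow S"
    then have fA: "finite A" using S(1) finite_subset by auto
    have "Mu p a A \<in> L ((sum p A + 1) + 1)"
      using Mu_degree[OF fA, of a p] A a by (auto simp: add.assoc)
    then have "Mu (p(0 := sum p A + 1)) (a(0 := Mu p a A)) (insert 0 (S - A)) = - proj (?X A)"
      using S a by (intro Mu_insert_0) auto
    then show "sg (koszul p A (S - A)) (Mu (p(0 := sum p A + 1)) (a(0 := Mu p a A)) (insert 0 (S - A)))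
      = - sg (koszul p A (S - A)) (proj (?X A))" by (simp add: sg_minus)
  qed
  also have "\<dots> = - proj (\<Sum>A\<in>Pow S. sg (koszul p A (S - A)) (?X A))"
    by (simp add: sum_negf module_hom.sum[OF proj_linear] hom_sg[OF proj_linear])
  also have "\<dots> = proj (convolve p (dPhi_Mu p a) (Phi p a) S)"
    by (simp add: sum_pointed_convolve_Mu[OF S(1)] module_hom.neg[OF proj_linear])
  also have "convolve p (dPhi_Mu p a) (Phi p a) S = convolve p (\<lambda>A. - curvature p a A) (Phi p a) S"
    by (rule convolve_cong) (use assms in \<open>auto intro!: dPhi_Mu_eq_curvature intro: finite_subset\<close>)
  also have "proj \<dots> = 0"
    using proj_convolve_curvature[OF S(1) a(1)]
    by (simp add: convolve_neg_left module_hom.neg[OF proj_linear])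
  finally show ?thesis .
qed

end


section \<open>From shifted to unshifted signs of trees\<close>

lemma length_left_steps [simp]: "length (left_steps t) = size1 t"
  by (induction t) auto

lemma sum_list_map_Suc: "sum_list (map Suc xs) = sum_list xs + length xs"
  by (induction xs) auto

lemma tree_degree_map_tree:
  "tree_degree (map_tree (\<lambda>_. (- 1, b)) t) = 1 - int (size1 t)"
  by (induction t) auto

lemma decorate_root_same: "decorate_root b b t = map_tree (\<lambda>_. b) t"
  by (cases t) auto

context homotopy_transfer
begin

text \<open>
  The tree sign, the exterior sign of the arrangement and \<open>decalage\<close> together account for the
  difference between the Koszul signs of \<open>\<phi>(B)\<close> and those of \<open>convolve\<close>.  At the root, the left
  subtree contributes one left step for each of its leaves, and the right subtree has degree
  \<open>1 - size1 r\<close>.  The roots of the subtrees carry \<open>(-1, \<eta> \<circ> [\<cdot>, \<cdot>])\<close> instead of the decoration of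
  the root, which is why the induction has to vary \<open>q\<close> and \<open>f\<close>.
\<close>

lemma tree_term_eval:
  assumes "distinct ws" "length ws = size1 t" and f: "module_hom scale scale f"
  shows "tree_term (\<lambda>i. dg i - 1) a f t ws
    = sg (int (sum_list (left_steps t)) + word_exponent dg ws + decalage dg (set ws))
        (tree_map_eval scale
          (decorate_root (q, \<lambda>x y. f (bracket x y)) (- 1, \<lambda>x y. \<eta> (bracket x y)) t)
          (map dg ws) (map a ws))"
  using assms
proof (induction t arbitrary: ws f q)
  case Leaf
  then obtain i where "ws = [i]" by (auto simp: length_Suc_conv)
  then show ?case by (simp add: decalage_def)
next
  case (Node l x r)
  let ?p = "\<lambda>i. dg i - 1"
  let ?g = "\<lambda>x y. \<eta> (bracket x y)"
  let ?u = "take (size1 l) ws" and ?v = "drop (size1 l) ws"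
  let ?ev = "\<lambda>t ws. tree_map_eval scale (map_tree (\<lambda>_. (- 1, ?g)) t) (map dg ws) (map a ws)"
  let ?U = "set ?u" and ?V = "set ?v"
  let ?e = "\<lambda>t ws. int (sum_list (left_steps t)) + word_exponent dg ws + decalage dg (set ws)"
  have dist: "distinct ?u" "distinct ?v" "distinct (?u @ ?v)" using Node.prems(1) by auto
  have disj: "?U \<inter> ?V = {}" using dist(3) by (simp only: distinct_append)
  have len: "length ?u = size1 l" "length ?v = size1 r" using Node.prems(2) by simp_all
  have card: "card ?U = size1 l" "card ?V = size1 r"
    using distinct_card[OF dist(1)] distinct_card[OF dist(2)] len by simp_all
  have IH: "tree_term ?p a \<eta> l ?u = sg (?e l ?u) (?ev l ?u)" "tree_term ?p a \<eta> r ?v = sg (?e r ?v) (?ev r ?v)"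
    using Node.IH(1)[OF dist(1) len(1) \<eta>_linear, of "- 1"] Node.IH(2)[OF dist(2) len(2) \<eta>_linear, of "- 1"]
    by (simp_all only: decorate_root_same)
  have "word_exponent dg (?u @ ?v) = word_exponent dg ?u + word_exponent dg ?v
      + crossing (\<lambda>i j. 1 + dg i * dg j) ?U ?V"
    by (rule word_exponent_append[OF dist(3)])
  then have we: "word_exponent dg ws = word_exponent dg ?u + word_exponent dg ?v
      + crossing (\<lambda>i j. 1 + dg i * dg j) ?U ?V" by simp
  have "set ws = ?U \<union> ?V" by (simp flip: set_append)
  then have de: "decalage dg (set ws) = decalage dg ?U + decalage dg ?V + int (size1 r) * sum dg ?U
      + crossing (\<lambda>i j. dg j - dg i) ?U ?V"
    using decalage_Un[OF _ _ disj] card by simp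
  have sp: "sum ?p ?U = sum dg ?U - int (size1 l)" using card by (simp add: sum_subtractf)
  have sd: "sum_list (map dg ?u) = sum dg ?U" using dist(1) by (simp add: sum_list_distinct_conv_sum_set)
  let ?c = "crossing (\<lambda>i j. 1 + dg i * dg j) ?U ?V" and ?c' = "crossing (\<lambda>i j. dg j - dg i) ?U ?V"
  obtain z where z: "?c + ?c' - koszul ?p ?U ?V = 2 * z" by (rule evenE[OF even_crossing_decalage])
  have "tree_term ?p a f (Node l x r) ws
      = sg (sum ?p ?U + koszul ?p ?U ?V + ?e l ?u + ?e r ?v) (f (bracket (?ev l ?u) (?ev r ?v)))"
    by (simp add: IH bracket_sg hom_sg[OF Node.prems(3)] ac_simps)
  also have "\<dots> = sg (?e (Node l x r) ws + (1 - int (size1 r)) * sum dg ?U) (f (bracket (?ev l ?u) (?ev r ?v)))"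
  proof (rule sg_cong)
    have "sum ?p ?U + koszul ?p ?U ?V + ?e l ?u + ?e r ?v - (?e (Node l x r) ws + (1 - int (size1 r)) * sum dg ?U)
      = - 2 * int (size1 l) - 2 * z"
      unfolding sp we de using z by (simp add: sum_list_map_Suc algebra_simps)
    then show "even (sum ?p ?U + koszul ?p ?U ?V + ?e l ?u + ?e r ?v
        - (?e (Node l x r) ws + (1 - int (size1 r)) * sum dg ?U))" by simp
  qed
  also have "\<dots> = sg (?e (Node l x r) ws) (tree_map_eval scale
      (decorate_root (q, \<lambda>x y. f (bracket x y)) (- 1, ?g) (Node l x r)) (map dg ws) (map a ws))"
    by (simp add: tree_degree_map_tree scale_ksgn take_map drop_map sd Let_def)
  finally show ?case .
qed

lemma tree_formula_eq_Mu:
  assumes S: "finite S" "2 \<le> card S"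
  defines "s \<equiv> sorted_list_of_set S"
  shows "tree_formula scale \<iota> d bracket \<eta> (card S) (map dg s) (map a s)
       = sg (decalage dg S) (Mu (\<lambda>i. dg i - 1) a S)"
proof -
  let ?n = "card S" and ?p = "\<lambda>i. dg i - 1"
  let ?c = "\<iota> ((- 1 / 2) ^ (card S - 1))"
  let ?T = "\<lambda>\<phi>. tree_map_eval scale (decorate_root (0, \<lambda>x y. proj (bracket x y)) (- 1, \<lambda>x y. \<eta> (bracket x y)) \<phi>)"
  have s: "distinct s" "set s = S" "length s = ?n" "sorted_wrt (<) s" using S by (simp_all add: s_def)
  have alpha: "comp_alpha scale (?T \<phi>) (map dg s) (map a s)
      = (\<Sum>ws\<in>permutations_of_set S. sg (word_exponent dg ws) (?T \<phi> (map dg ws) (map a ws)))" for \<phi>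
  proof -
    let ?f = "\<lambda>ws. sg (word_exponent dg ws) (?T \<phi> (map dg ws) (map a ws))"
    have "comp_alpha scale (?T \<phi>) (map dg s) (map a s)
      = (\<Sum>\<sigma> | \<sigma> permutes {..<length s}. ?f (permute_list \<sigma> s))"
      unfolding comp_alpha_def
      by (intro sum.cong) (auto simp: chi_word_exponent[OF s(4)] scale_ksgn permute_list_map)
    then show ?thesis
      using sum_permutes_permutations_of_set[OF s(1), of ?f] s(2) by simp
  qed
  have summand: "scale (tree_sign \<phi>) (sg (word_exponent dg ws) (?T \<phi> (map dg ws) (map a ws)))
      = sg (decalage dg S) (tree_term ?p a proj \<phi> ws)"
    if "\<phi> \<in> Ot ?n" "ws \<in> permutations_of_set S" for \<phi> ws
  proof -
    have ws: "distinct ws" "set ws = S" "length ws = size1 \<phi>"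
      using that by (auto simp: permutations_of_set_def Ot_def distinct_card)
    have "sg (decalage dg S) (tree_term ?p a proj \<phi> ws)
       = sg (int (sum_list (left_steps \<phi>)) + word_exponent dg ws) (?T \<phi> (map dg ws) (map a ws))"
      unfolding tree_term_eval[OF ws(1,3) proj_linear, of dg a 0] sg_sg ws(2)
      by (rule sg_cong) simp
    then show ?thesis by (simp add: tree_sign_def minus_one_power_ksgn scale_ksgn)
  qed
  have "tree_formula scale \<iota> d bracket \<eta> ?n (map dg s) (map a s)
      = scale ?c (\<Sum>\<phi>\<in>Ot ?n. \<Sum>ws\<in>permutations_of_set S. sg (decalage dg S) (tree_term ?p a proj \<phi> ws))"
    unfolding tree_formula_def Let_def proj_def[symmetric] alpha
    by (simp add: scale_sum_right summand cong: sum.cong)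
  also have "\<dots> = sg (decalage dg S) (tree_sum ?p a proj S)"
    by (simp only: tree_sum_def sum.cartesian_product[symmetric] scale_sum_right sg_sum hom_sg[OF module_hom_scale_self])
  also have "tree_sum ?p a proj S = Mu ?p a S"
    unfolding Mu_def by (rule tree_sum_convolve[OF S proj_linear])
  finally show ?thesis .
qed

end


section \<open>Multilinearity of tree maps\<close>

lemma permute_list_update:
  assumes "\<sigma> permutes {..<length xs}" "i < length xs"
  shows "permute_list \<sigma> (xs[i := x]) = (permute_list \<sigma> xs)[inv \<sigma> i := x]"
proof (rule nth_equalityI)
  fix j assume "j < length (permute_list \<sigma> (xs[i := x]))"
  then have j: "j < length xs" by simp
  have "\<sigma> j < length xs" using permutes_in_image[OF assms(1), of j] j by simp
  moreover have "inv \<sigma> i = j \<longleftrightarrow> \<sigma> j = i" using permutes_inv_eq[OF assms(1)] by auto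
  ultimately show "permute_list \<sigma> (xs[i := x]) ! j = (permute_list \<sigma> xs)[inv \<sigma> i := x] ! j"
    using j assms by (auto simp: permute_list_nth nth_list_update)
qed simp

context module
begin

lemma linearI:
  assumes "\<And>x y. f (x + y) = f x + f y" "\<And>c x. f (scale c x) = scale c (f x)"
  shows "module_hom scale scale f"
  using assms module_axioms by (simp add: module_hom_iff)

lemma linear_scale: "module_hom scale scale f \<Longrightarrow> module_hom scale scale (\<lambda>x. scale c (f x))"
  by (rule linearI) (simp_all add: module_hom.add module_hom.scale scale_right_distrib mult.commute)

lemma linear_sum:
  "(\<And>i. i \<in> I \<Longrightarrow> module_hom scale scale (f i)) \<Longrightarrow> module_hom scale scale (\<lambda>x. \<Sum>i\<in>I. f i x)"
  by (rule linearI; unfold sum.distrib[symmetric] scale_sum_right)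
     (intro sum.cong refl module_hom.add module_hom.scale, assumption)+

lemma linear_comp:
  "module_hom scale scale f \<Longrightarrow> module_hom scale scale g \<Longrightarrow> module_hom scale scale (\<lambda>x. f (g x))"
  by (rule linearI) (simp_all add: module_hom.add module_hom.scale)

text \<open>
  For fixed degrees \<open>ds\<close> the signs are constants, and the tree map is a composite of the bilinear maps
  at its ramifications.
\<close>

lemma tree_map_eval_linear:
  assumes "\<And>q b. (q, b) \<in> set_tree t \<Longrightarrow>
      (\<forall>y. module_hom scale scale (\<lambda>x. b x y)) \<and> (\<forall>x. module_hom scale scale (b x))"
    and "length xs = size1 t" "i < length xs"
  shows "module_hom scale scale (\<lambda>x. tree_map_eval scale t ds (xs[i := x]))"
  using assms
proof (induction t arbitrary: ds xs i)
  case Leaf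
  then obtain z where "xs = [z]" by (auto simp: length_Suc_conv)
  then show ?case using Leaf.prems(3) by (auto intro: linearI)
next
  case (Node l v r)
  obtain q b where v: "v = (q, b)" by (cases v)
  have b: "module_hom scale scale (\<lambda>x. b x y)" "module_hom scale scale (b z)" for y z
    using Node.prems(1)[of q b] v by auto
  let ?m = "size1 l"
  have len: "length (take ?m xs) = size1 l" "length (drop ?m xs) = size1 r" using Node.prems(2) by simp_all
  show ?case
  proof (cases "i < ?m")
    case True
    then have "take ?m (xs[i := x]) = (take ?m xs)[i := x]" "drop ?m (xs[i := x]) = drop ?m xs" for x
      by (simp_all add: take_update_swap)
    moreover have "module_hom scale scale (\<lambda>x. tree_map_eval scale l (take ?m ds) ((take ?m xs)[i := x]))"
      using Node.prems(1) len True by (intro Node.IH(1)) auto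
    ultimately show ?thesis
      by (simp add: v Let_def) (intro linear_scale linear_comp[OF b(1)])
  next
    case False
    then have "take ?m (xs[i := x]) = take ?m xs" "drop ?m (xs[i := x]) = (drop ?m xs)[i - ?m := x]" for x
      by (simp_all add: drop_update_swap)
    moreover have "module_hom scale scale (\<lambda>x. tree_map_eval scale r (drop ?m ds) ((drop ?m xs)[i - ?m := x]))"
      using Node.prems len False by (intro Node.IH(2)) auto
    ultimately show ?thesis
      by (simp add: v Let_def) (intro linear_scale linear_comp[OF b(2)])
  qed
qed

end

context homotopy_transfer
begin


section \<open>Homogeneous components\<close>

lemma hcomp_decomposition: "homogeneous_decomposition L x (hcomp L x)"
  unfolding hcomp_def by (rule theI'[OF direct_sum]) simp

lemma hcomp_degree: "hcomp L x i \<in> L i"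
  and hcomp_finite: "finite {i. hcomp L x i \<noteq> 0}"
  and sum_hcomp: "(\<Sum>i | hcomp L x i \<noteq> 0. hcomp L x i) = x"
  using hcomp_decomposition[of x] by (auto simp: homogeneous_decomposition_def)

lemma hcomp_eqI:
  assumes "finite D" "\<And>i. c i \<in> L i" "\<And>i. c i \<noteq> 0 \<Longrightarrow> i \<in> D" "x = (\<Sum>i\<in>D. c i)"
  shows "hcomp L x = c"
proof -
  have "(\<Sum>i\<in>D. c i) = (\<Sum>i | c i \<noteq> 0. c i)"
    using assms(1,3) by (intro sum.mono_neutral_right) auto
  moreover have "finite {i. c i \<noteq> 0}"
    using assms(1,3) by (auto intro: finite_subset[of _ D])
  ultimately have "homogeneous_decomposition L x c"
    using assms(2,4) by (simp add: homogeneous_decomposition_def)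
  then show ?thesis using direct_sum[of x] hcomp_decomposition[of x] by auto
qed

lemma sum_hcomp_superset:
  "finite D \<Longrightarrow> {i. hcomp L x i \<noteq> 0} \<subseteq> D \<Longrightarrow> (\<Sum>i\<in>D. hcomp L x i) = x"
  by (subst (2) sum_hcomp[symmetric]) (rule sum.mono_neutral_right; auto)

lemma hcomp_linear: "module_hom scale scale (\<lambda>x. hcomp L x i)"
proof (rule linearI)
  fix x y
  let ?D = "{i. hcomp L x i \<noteq> 0} \<union> {i. hcomp L y i \<noteq> 0}"
  have D: "finite ?D" by (simp add: hcomp_finite)
  have "x + y = (\<Sum>i\<in>?D. hcomp L x i + hcomp L y i)"
    using sum_hcomp_superset[OF D, of x] sum_hcomp_superset[OF D, of y] by (simp add: sum.distrib)
  then have "hcomp L (x + y) = (\<lambda>i. hcomp L x i + hcomp L y i)"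
    using D by (intro hcomp_eqI[of ?D]) (auto simp: L_add hcomp_degree)
  then show "hcomp L (x + y) i = hcomp L x i + hcomp L y i" by simp
next
  fix c x
  have "hcomp L (scale c x) = (\<lambda>i. scale c (hcomp L x i))"
    by (rule hcomp_eqI[OF hcomp_finite[of x]])
       (auto simp: L_scale hcomp_degree sum_hcomp simp flip: scale_sum_right)
  then show "hcomp L (scale c x) i = scale c (hcomp L x i)" by simp
qed

lemma hcomp_homogeneous: "x \<in> L k \<Longrightarrow> hcomp L x = (\<lambda>i. if i = k then x else 0)"
  by (rule hcomp_eqI[of "{k}"]) (auto simp: L_0 split: if_splits)

lemma comm_op_degree: "x \<in> L i \<Longrightarrow> comm_op d \<eta> x \<in> L i"
  using L_diff[OF _ proj_degree, of x i x] by (simp add: proj_def)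

lemma hcomp_comm_op: "hcomp L (comm_op d \<eta> x) i = comm_op d \<eta> (hcomp L x i)"
proof -
  have "comm_op d \<eta> x = (\<Sum>i | hcomp L x i \<noteq> 0. comm_op d \<eta> (hcomp L x i))"
    unfolding module_hom.sum[OF comm_op_linear, symmetric] sum_hcomp ..
  then have "hcomp L (comm_op d \<eta> x) = (\<lambda>i. comm_op d \<eta> (hcomp L x i))"
    by (intro hcomp_eqI[OF hcomp_finite[of x]])
       (auto simp: comm_op_degree hcomp_degree module_hom.zero[OF comm_op_linear])
  then show ?thesis by simp
qed

abbreviation H :: "'a set" where
  "H \<equiv> ker_comm_op d \<eta>"

lemma H_subspace: "subspace H"
  unfolding ker_comm_op_def by (rule module_hom.subspace_kernel[OF comm_op_linear])

lemma hcomp_H: "x \<in> H \<Longrightarrow> hcomp L x i \<in> H"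
  using hcomp_comm_op[of x i]
  by (simp add: ker_comm_op_def module_hom.zero[OF hcomp_linear])

lemma graded_module_H: "graded_module scale H (\<lambda>i. H \<inter> L i)"
proof (intro graded_module.intro module_axioms graded_module_axioms.intro)
  fix x assume x: "x \<in> H"
  show "\<exists>!c. homogeneous_decomposition (\<lambda>i. H \<inter> L i) x c"
  proof (rule ex1I)
    show "homogeneous_decomposition (\<lambda>i. H \<inter> L i) x (hcomp L x)"
      using hcomp_decomposition[of x] hcomp_H[OF x] by (simp add: homogeneous_decomposition_def)
    fix c assume "homogeneous_decomposition (\<lambda>i. H \<inter> L i) x c"
    then have "homogeneous_decomposition L x c" by (simp add: homogeneous_decomposition_def)
    then show "c = hcomp L x" using direct_sum[of x] hcomp_decomposition[of x] by auto
  qed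
qed (use H_subspace in \<open>auto intro: subspace_inter subspace_degree\<close>)

text \<open>
  Enlarging the index set to all lists over a fixed finite set of degrees makes it independent of
  the arguments, so that linearity can be checked summand by summand.
\<close>

lemma multilinear_extension_superset:
  assumes D: "finite D" "\<And>x i. x \<in> set xs \<Longrightarrow> hcomp L x i \<noteq> 0 \<Longrightarrow> i \<in> D"
    and F: "\<And>ds zs. length zs = length xs \<Longrightarrow> 0 \<in> set zs \<Longrightarrow> F ds zs = 0"
  shows "multilinear_extension L F xs
       = (\<Sum>ds | set ds \<subseteq> D \<and> length ds = length xs. F ds (map2 (hcomp L) xs ds))"
  unfolding multilinear_extension_def
proof (rule sum.mono_neutral_left)
  show "finite {ds. set ds \<subseteq> D \<and> length ds = length xs}"
    by (rule finite_lists_length_eq[OF D(1)])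
  show "{ds. length ds = length xs \<and> (\<forall>j<length xs. hcomp L (xs ! j) (ds ! j) \<noteq> 0)}
      \<subseteq> {ds. set ds \<subseteq> D \<and> length ds = length xs}"
  proof clarsimp
    fix ds e assume ds: "length ds = length xs" "\<forall>j<length xs. hcomp L (xs ! j) (ds ! j) \<noteq> 0" "e \<in> set ds"
    then obtain j where "j < length xs" "e = ds ! j" by (metis in_set_conv_nth)
    then show "e \<in> D" using ds D(2)[of "xs ! j" e] by simp
  qed
  show "\<forall>ds\<in>{ds. set ds \<subseteq> D \<and> length ds = length xs}
        - {ds. length ds = length xs \<and> (\<forall>j<length xs. hcomp L (xs ! j) (ds ! j) \<noteq> 0)}.
      F ds (map2 (hcomp L) xs ds) = 0"
  proof
    fix ds assume "ds \<in> {ds. set ds \<subseteq> D \<and> length ds = length xs}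
        - {ds. length ds = length xs \<and> (\<forall>j<length xs. hcomp L (xs ! j) (ds ! j) \<noteq> 0)}"
    then obtain j where j: "length ds = length xs" "j < length xs" "hcomp L (xs ! j) (ds ! j) = 0" by auto
    then have "map2 (hcomp L) xs ds ! j = 0" "j < length (map2 (hcomp L) xs ds)" by simp_all
    then have "0 \<in> set (map2 (hcomp L) xs ds)" by (metis nth_mem)
    then show "F ds (map2 (hcomp L) xs ds) = 0" using j(1) by (intro F) auto
  qed
qed

lemma multilinear_extension_linear:
  assumes F: "\<And>ds zs i. length zs = length xs \<Longrightarrow> i < length xs \<Longrightarrow>
      module_hom scale scale (\<lambda>x. F ds (zs[i := x]))"
    and i: "i < length xs"
  shows "module_hom scale scale (\<lambda>x. multilinear_extension L F (xs[i := x]))"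
proof -
  have F0: "F ds zs = 0" if len: "length zs = length xs" and z: "0 \<in> set zs" for ds zs
  proof -
    obtain j where "j < length zs" "zs ! j = 0" using z by (metis in_set_conv_nth)
    then show ?thesis using module_hom.zero[OF F[OF len, of j ds]] len list_update_id[of zs j] by simp
  qed
  have eq: "multilinear_extension L F (xs[i := x])
      = (\<Sum>ds | set ds \<subseteq> D \<and> length ds = length xs. F ds ((map2 (hcomp L) xs ds)[i := hcomp L x (ds ! i)]))"
    if D: "finite D" "\<And>y k. y \<in> insert x (set xs) \<Longrightarrow> hcomp L y k \<noteq> 0 \<Longrightarrow> k \<in> D" for x D
  proof -
    have D': "k \<in> D" if "y \<in> set (xs[i := x])" "hcomp L y k \<noteq> 0" for y k
      using that D(2) set_update_subset_insert[of xs i x] by blast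
    have "multilinear_extension L F (xs[i := x])
      = (\<Sum>ds | set ds \<subseteq> D \<and> length ds = length (xs[i := x]). F ds (map2 (hcomp L) (xs[i := x]) ds))"
      by (rule multilinear_extension_superset[OF D(1) D' F0]) simp_all
    also have "\<dots> = (\<Sum>ds | set ds \<subseteq> D \<and> length ds = length xs. F ds ((map2 (hcomp L) xs ds)[i := hcomp L x (ds ! i)]))"
    proof (intro sum.cong)
      fix ds :: "int list"
      assume "ds \<in> {ds. set ds \<subseteq> D \<and> length ds = length xs}"
      then have "zip (xs[i := x]) ds = (zip xs ds)[i := (x, ds ! i)]"
        using zip_update[of xs i x ds "ds ! i"] by simp
      then show "F ds (map2 (hcomp L) (xs[i := x]) ds) = F ds ((map2 (hcomp L) xs ds)[i := hcomp L x (ds ! i)])"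
        by (simp add: map_update)
    qed simp
    finally show ?thesis .
  qed
  \<comment> \<open>stated for every \<open>D\<close>, because the degrees that occur depend on the vectors to be added or scaled\<close>
  have lin: "module_hom scale scale (\<lambda>x. \<Sum>ds | set ds \<subseteq> D \<and> length ds = length xs.
      F ds ((map2 (hcomp L) xs ds)[i := hcomp L x (ds ! i)]))" for D
    by (intro linear_sum linear_comp[OF F hcomp_linear]) (use i in auto)
  have supp: "finite (\<Union>y\<in>insert u (insert v (insert w (set xs))). {k. hcomp L y k \<noteq> 0})" for u v w
    by (simp add: hcomp_finite)
  show ?thesis
  proof (rule linearI)
    fix x y
    let ?D = "\<Union>z\<in>insert x (insert y (insert (x + y) (set xs))). {k. hcomp L z k \<noteq> 0}"
    show "multilinear_extension L F (xs[i := x + y])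
        = multilinear_extension L F (xs[i := x]) + multilinear_extension L F (xs[i := y])"
      using module_hom.add[OF lin[of ?D], of x y] supp[of x y "x + y"] by (subst (1 2 3) eq[of ?D]) auto
  next
    fix c x
    let ?D = "\<Union>z\<in>insert x (insert x (insert (scale c x) (set xs))). {k. hcomp L z k \<noteq> 0}"
    show "multilinear_extension L F (xs[i := scale c x]) = scale c (multilinear_extension L F (xs[i := x]))"
      using module_hom.scale[OF lin[of ?D], of c x] supp[of x x "scale c x"] by (subst (1 2) eq[of ?D]) auto
  qed
qed

lemma multilinear_extension_homogeneous:
  assumes "homogeneous_list L ds xs"
    and F: "\<And>ds zs. length zs = length xs \<Longrightarrow> 0 \<in> set zs \<Longrightarrow> F ds zs = 0"
  shows "multilinear_extension L F xs = F ds xs"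
proof -
  have len: "length ds = length xs" and deg: "\<And>j. j < length xs \<Longrightarrow> xs ! j \<in> L (ds ! j)"
    using assms(1) by (auto simp: homogeneous_list_def list_all2_conv_all_nth)
  have hc: "hcomp L (xs ! j) = (\<lambda>i. if i = ds ! j then xs ! j else 0)" if "j < length xs" for j
    using deg[OF that] by (rule hcomp_homogeneous)
  show ?thesis
  proof (cases "0 \<in> set xs")
    case True
    then obtain j where "j < length xs" "xs ! j = 0" by (metis in_set_conv_nth)
    then have "\<not> (\<forall>j<length xs. hcomp L (xs ! j) (es ! j) \<noteq> 0)" for es :: "int list"
      using hc[of j] by auto
    then have "{es. length es = length xs \<and> (\<forall>j<length xs. hcomp L (xs ! j) (es ! j) \<noteq> 0)} = {}" by blast
    then have "multilinear_extension L F xs = 0" by (simp only: multilinear_extension_def sum.empty)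
    then show ?thesis using F[OF refl True] by simp
  next
    case False
    have "{es. length es = length xs \<and> (\<forall>j<length xs. hcomp L (xs ! j) (es ! j) \<noteq> 0)} = {ds}"
    proof (intro equalityI subsetI; clarsimp)
      fix es :: "int list"
      assume "length es = length xs" "\<forall>j<length xs. hcomp L (xs ! j) (es ! j) \<noteq> 0"
      then show "es = ds" using len hc by (intro nth_equalityI) (auto split: if_splits)
    next
      show "length ds = length xs \<and> (\<forall>j<length xs. hcomp L (xs ! j) (ds ! j) \<noteq> 0)"
        using len hc False by (auto simp: in_set_conv_nth)
    qed
    moreover have "map2 (hcomp L) xs ds = xs"
      using len hc by (intro nth_equalityI) auto
    ultimately show ?thesis by (simp add: multilinear_extension_def)
  qed
qed

end


section \<open>The transferred structure\<close>

lemma set_tree_map_const: "set_tree (map_tree (\<lambda>_. g) t) \<subseteq> {g}"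
  by (induction t) auto

lemma set_tree_decorate_root: "set_tree (decorate_root b g t) \<subseteq> {b, g}"
  using set_tree_map_const[of g] by (cases t) auto

context homotopy_transfer
begin

abbreviation mu :: "nat \<Rightarrow> 'a list \<Rightarrow> 'a" where
  "mu \<equiv> transferred_mu scale \<iota> L d bracket \<eta>"

abbreviation mu_tree :: "nat \<Rightarrow> int list \<Rightarrow> 'a list \<Rightarrow> 'a" where
  "mu_tree \<equiv> tree_formula scale \<iota> d bracket \<eta>"

lemma mu_tree_linear:
  assumes "length xs = n" "i < n"
  shows "module_hom scale scale (\<lambda>x. mu_tree n ds (xs[i := x]))"
proof -
  let ?t = "\<lambda>\<phi>. decorate_root (0, \<lambda>x y. proj (bracket x y)) (- 1, \<lambda>x y. \<eta> (bracket x y)) \<phi>"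
  have bilinear: "(\<forall>y. module_hom scale scale (\<lambda>x. b x y)) \<and> (\<forall>x. module_hom scale scale (b x))"
    if "(q, b) \<in> set_tree (?t \<phi>)" for q b \<phi>
  proof -
    have "b = (\<lambda>x y. proj (bracket x y)) \<or> b = (\<lambda>x y. \<eta> (bracket x y))"
      using subsetD[OF set_tree_decorate_root that] by auto
    then show ?thesis
      by (auto intro: linear_comp[OF proj_linear] linear_comp[OF \<eta>_linear] bracket_linear_left bracket_linear_right)
  qed
  have size: "size1 (?t \<phi>) = size1 \<phi>" for \<phi> by (cases \<phi>) (simp_all add: size1_size)
  have "module_hom scale scale (\<lambda>x. tree_map_eval scale (?t \<phi>) (permute_list \<sigma> ds) (permute_list \<sigma> (xs[i := x])))"
    if \<phi>: "\<phi> \<in> Ot n" and \<sigma>: "\<sigma> permutes {..<n}" for \<phi> \<sigma>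
  proof -
    have "inv \<sigma> i < n" using permutes_in_image[OF permutes_inv[OF \<sigma>], of i] assms(2) by simp
    then show ?thesis
      using assms \<sigma> \<phi>
      by (simp add: permute_list_update) (intro tree_map_eval_linear bilinear; simp add: size Ot_def)
  qed
  then show ?thesis
    unfolding tree_formula_def Let_def comp_alpha_def proj_def[symmetric] length_list_update assms(1)
    by (intro linear_scale linear_sum) auto
qed

lemma mu_tree_eq_0:
  assumes "length xs = n" "0 \<in> set xs"
  shows "mu_tree n ds xs = 0"
proof -
  obtain j where "j < length xs" "xs ! j = 0" using assms(2) by (metis in_set_conv_nth)
  then show ?thesis
    using module_hom.zero[OF mu_tree_linear[OF assms(1), of j ds]] assms(1) list_update_id[of xs j] by simp
qed

lemma mu_linear:
  assumes "length xs = n" "i < n"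
  shows "module_hom scale scale (\<lambda>x. mu n (xs[i := x]))"
proof (cases "n \<le> 1")
  case True
  then show ?thesis by (intro linearI) (simp_all add: transferred_mu_def)
next
  case False
  have "module_hom scale scale (\<lambda>x. multilinear_extension L (mu_tree n) (xs[i := x]))"
    using assms by (intro multilinear_extension_linear mu_tree_linear) simp_all
  then show ?thesis using False by (simp add: transferred_mu_def)
qed

lemma mu_homogeneous:
  assumes "2 \<le> n" "length xs = n" "homogeneous_list L ds xs"
  shows "mu n xs = mu_tree n ds xs"
proof -
  have "multilinear_extension L (mu_tree n) xs = mu_tree n ds xs"
    using assms by (intro multilinear_extension_homogeneous mu_tree_eq_0) simp_all
  then show ?thesis using assms(1) by (simp add: transferred_mu_def)
qed

text \<open>
  For one-element \<open>S\<close> both sides vanish, in accordance with \<open>\<mu>\<^sub>1 = 0\<close>.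
\<close>

lemma mu_eq_Mu:
  assumes "finite S" "S \<noteq> {}" "\<And>i. i \<in> S \<Longrightarrow> a i \<in> L (dg i)"
  shows "mu (card S) (map a (sorted_list_of_set S)) = sg (decalage dg S) (Mu (\<lambda>i. dg i - 1) a S)"
proof (cases rule: finite_size_cases[OF assms(1)])
  case (2 i)
  then show ?thesis by (simp add: transferred_mu_def Mu_small)
next
  case 3
  let ?s = "sorted_list_of_set S"
  have "homogeneous_list L (map dg ?s) (map a ?s)"
    using assms by (simp add: homogeneous_list_def list_all2_conv_all_nth) (metis nth_mem length_sorted_list_of_set set_sorted_list_of_set)
  then have "mu (card S) (map a ?s) = mu_tree (card S) (map dg ?s) (map a ?s)"
    using 3 by (intro mu_homogeneous) simp_all
  then show ?thesis using tree_formula_eq_Mu[OF assms(1) 3] by simp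
qed (use assms in simp)

lemma mu_in_H: "mu n xs \<in> H"
proof (cases "n \<le> 1")
  case True
  then show ?thesis by (simp add: transferred_mu_def subspace_0[OF H_subspace])
next
  case False
  let ?t = "\<lambda>\<phi>. decorate_root (0, \<lambda>x y. proj (bracket x y)) (- 1, \<lambda>x y. \<eta> (bracket x y)) \<phi>"
  have "tree_map_eval scale (?t \<phi>) ds zs \<in> H" if "\<phi> \<in> Ot n" for \<phi> ds zs
    using that False
    by (cases \<phi>) (auto simp: Ot_def Let_def intro!: subspace_scale[OF H_subspace] proj_mem_ker)
  then have "mu_tree n ds zs \<in> H" for ds zs
    unfolding tree_formula_def Let_def comp_alpha_def proj_def[symmetric]
    by (intro subspace_scale[OF H_subspace] subspace_sum[OF H_subspace])
  then show ?thesis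
    using False by (simp add: transferred_mu_def multilinear_extension_def subspace_sum[OF H_subspace])
qed

lemma mu_antisymmetric:
  assumes "length xs = n" "homogeneous_list L ds xs" "\<sigma> permutes {..<n}"
  shows "mu n (permute_list \<sigma> xs) = scale (chi \<sigma> ds) (mu n xs)"
proof (cases "n \<le> 1")
  case False
  have len: "length ds = length xs" using assms(2) by (auto simp: homogeneous_list_def dest: list_all2_lengthD)
  have hom: "homogeneous_list L (permute_list \<sigma> ds) (permute_list \<sigma> xs)"
    using assms len by (simp add: homogeneous_list_def list_all2_permute_list_iff)
  have alpha: "comp_alpha scale T (permute_list \<sigma> ds) (permute_list \<sigma> xs)
      = scale (chi \<sigma> ds) (comp_alpha scale T ds xs)" for T
    using assms(1,3) by (intro comp_alpha_permute[OF module_axioms len]) simp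
  have "mu_tree n (permute_list \<sigma> ds) (permute_list \<sigma> xs) = scale (chi \<sigma> ds) (mu_tree n ds xs)"
    unfolding tree_formula_def Let_def alpha
    by (simp only: scale_left_commute[of _ "chi \<sigma> ds"] flip: scale_sum_right)
  then show ?thesis
    using mu_homogeneous[OF _ assms(1,2)] mu_homogeneous[OF _ _ hom] False assms(1) by simp
qed (simp add: transferred_mu_def)

lemma map_nth_pred: "map (\<lambda>i. xs ! (i - 1)) [1..<Suc (length xs)] = xs"
  by (rule nth_equalityI) (simp_all del: upt_Suc)

lemma homogeneous_listD:
  assumes "homogeneous_list L ds xs" "i \<in> {1..length xs}"
  shows "xs ! (i - 1) \<in> L (ds ! (i - 1))"
  using assms by (auto simp: homogeneous_list_def list_all2_conv_all_nth)

lemma mu_degree: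
  assumes "1 \<le> n" "length xs = n" "homogeneous_list L ds xs"
  shows "mu n xs \<in> L (sum_list ds + 2 - int n)"
proof -
  let ?dg = "\<lambda>i. ds ! (i - 1)" and ?a = "\<lambda>i. xs ! (i - 1)"
  have len: "length ds = n" using assms by (auto simp: homogeneous_list_def dest: list_all2_lengthD)
  have s: "sorted_list_of_set {1..n} = [1..<Suc n]"
    using sorted_list_of_set_sorted_wrt[of "[1..<Suc n]"] by (simp add: atLeastLessThanSuc_atLeastAtMost del: upt_Suc)
  have sum: "sum ?dg {1..n} = sum_list ds"
    using sum_list_distinct_conv_sum_set[of "[1..<Suc n]" ?dg] map_nth_pred[of ds] len
    by (simp add: atLeastLessThanSuc_atLeastAtMost del: upt_Suc)
  have a: "?a i \<in> L (?dg i)" if "i \<in> {1..n}" for i using homogeneous_listD[OF assms(3)] that assms(2) by simp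
  have "mu n xs = sg (decalage ?dg {1..n}) (Mu (\<lambda>i. ?dg i - 1) ?a {1..n})"
    using mu_eq_Mu[of "{1..n}" ?a ?dg] a assms(1,2) map_nth_pred[of xs] s by simp
  also have "\<dots> \<in> L (sum (\<lambda>i. ?dg i - 1) {1..n} + 2)"
    using a by (intro L_sg Mu_degree) simp_all
  also have "sum (\<lambda>i. ?dg i - 1) {1..n} + 2 = sum_list ds + 2 - int n"
    unfolding sum_subtractf sum by simp
  finally show ?thesis .
qed

lemma mu_insert_Mu:
  assumes B: "finite B" "0 \<notin> B" and a: "\<And>i. i \<in> B \<Longrightarrow> a i \<in> L (dg i)" and u: "u \<in> L q"
  shows "mu (Suc (card B)) (u # map a (sorted_list_of_set B))
       = sg (int (card B) * q + decalage dg B) (Mu ((\<lambda>i. dg i - 1)(0 := q - 1)) (a(0 := u)) (insert 0 B))"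
proof -
  let ?dg = "dg(0 := q)" and ?a = "a(0 := u)"
  have ne: "i \<noteq> 0" if "i \<in> B" for i using that B(2) by metis
  have "sorted_wrt (<) (0 # sorted_list_of_set B)" using B ne by auto
  then have "sorted_list_of_set (insert 0 B) = 0 # sorted_list_of_set B"
    using sorted_list_of_set_sorted_wrt[of "0 # sorted_list_of_set B"] B by simp
  moreover have "map ?a (sorted_list_of_set B) = map a (sorted_list_of_set B)"
    using B ne by (intro map_cong) auto
  ultimately have "mu (Suc (card B)) (u # map a (sorted_list_of_set B))
      = mu (card (insert 0 B)) (map ?a (sorted_list_of_set (insert 0 B)))"
    using B by simp
  also have "\<dots> = sg (decalage ?dg (insert 0 B)) (Mu (\<lambda>i. ?dg i - 1) ?a (insert 0 B))"
    using B a u ne by (intro mu_eq_Mu) auto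
  also have "(\<lambda>i. ?dg i - 1) = (\<lambda>i. dg i - 1)(0 := q - 1)" by auto
  also have "decalage ?dg (insert 0 B) = int (card B) * q + decalage ?dg B"
    using decalage_insert_0[OF B, of ?dg] by simp
  also have "decalage ?dg B = decalage dg B"
    unfolding decalage_def using ne by (intro sum.cong refl) auto
  finally show ?thesis .
qed

text \<open>
  One summand of the \<open>L\<^sub>\<infinity>\<close> identity in shifted degrees.  The inner value has the degree of
  its \<open>k\<close> arguments plus \<open>2 - k\<close>, so its \<open>decalage\<close> against the other \<open>l - 1\<close> arguments produces a
  sign \<open>(-1) ^ (k * (l - 1))\<close>, which cancels the one in the identity.  The remaining sign \<open>(-1) ^ decalage dg S\<close> is common to all summands.
\<close>

lemma mu_composite:
  assumes S: "finite S" "0 \<notin> S" and a: "\<And>i. i \<in> S \<Longrightarrow> a i \<in> L (dg i)"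
    and A: "A \<subseteq> S" "A \<noteq> {}"
  defines "p \<equiv> \<lambda>i. dg i - 1"
  shows "sg (int (card A * card (S - A)) + crossing (\<lambda>i j. 1 + dg i * dg j) A (S - A))
           (mu (Suc (card (S - A))) (mu (card A) (map a (sorted_list_of_set A)) # map a (sorted_list_of_set (S - A))))
       = sg (decalage dg S) (sg (koszul p A (S - A))
           (Mu (p(0 := sum p A + 1)) (a(0 := Mu p a A)) (insert 0 (S - A))))"
proof -
  let ?B = "S - A"
  let ?u = "Mu p a A" and ?rest = "map a (sorted_list_of_set ?B)"
  let ?c = "crossing (\<lambda>i j. 1 + dg i * dg j) A ?B" and ?c' = "crossing (\<lambda>i j. dg j - dg i) A ?B"
  have fA: "finite A" "finite ?B" using S(1) A(1) finite_subset by auto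
  have mem: "i \<in> S" if "i \<in> A" for i using A(1) that by auto
  have "?u \<in> L (sum p A + 2)" using fA a mem by (intro Mu_degree) (auto simp: p_def)
  then have outer: "mu (Suc (card ?B)) (?u # ?rest)
      = sg (int (card ?B) * (sum p A + 2) + decalage dg ?B) (Mu (p(0 := sum p A + 1)) (a(0 := ?u)) (insert 0 ?B))"
    using mu_insert_Mu[of ?B a dg ?u "sum p A + 2"] S a fA by (simp add: p_def add.commute)
  have inner: "mu (card A) (map a (sorted_list_of_set A)) = sg (decalage dg A) ?u"
    unfolding p_def using fA A(2) a mem by (intro mu_eq_Mu) auto
  have "mu (Suc (card ?B)) (sg m ?u # ?rest) = sg m (mu (Suc (card ?B)) (?u # ?rest))" for m
    using hom_sg[OF mu_linear[of "?u # ?rest" "Suc (card ?B)" 0], of m ?u] fA by simp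
  then have "sg (int (card A * card ?B) + ?c) (mu (Suc (card ?B)) (mu (card A) (map a (sorted_list_of_set A)) # ?rest))
      = sg (int (card A * card ?B) + ?c + (decalage dg A + (int (card ?B) * (sum p A + 2) + decalage dg ?B)))
          (Mu (p(0 := sum p A + 1)) (a(0 := ?u)) (insert 0 ?B))"
    by (simp add: inner outer)
  also have "\<dots> = sg (decalage dg S + koszul p A ?B) (Mu (p(0 := sum p A + 1)) (a(0 := ?u)) (insert 0 ?B))"
  proof (rule sg_cong)
    obtain z where z: "?c + ?c' - koszul p A ?B = 2 * z"
      unfolding p_def by (rule evenE[OF even_crossing_decalage])
    have "A \<union> ?B = S" using A(1) by auto
    then have decalage: "decalage dg S = decalage dg A + decalage dg ?B + int (card ?B) * sum dg A + ?c'"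
      using decalage_Un[OF fA, of dg] by simp
    have sum: "sum p A = sum dg A - int (card A)" by (simp add: p_def sum_subtractf)
    have "int (card A * card ?B) + ?c + (decalage dg A + (int (card ?B) * (sum p A + 2) + decalage dg ?B))
        - (decalage dg S + koszul p A ?B) = 2 * (int (card ?B) + z - ?c')"
      unfolding decalage sum using z by (simp add: algebra_simps)
    then show "even (int (card A * card ?B) + ?c + (decalage dg A + (int (card ?B) * (sum p A + 2) + decalage dg ?B))
        - (decalage dg S + koszul p A ?B))" by simp
  qed
  finally show ?thesis by simp
qed

lemma mu_identity:
  assumes "length xs = n" "homogeneous_list L ds xs" "set xs \<subseteq> H"
  shows "(\<Sum>(k, l) | 1 \<le> k \<and> 1 \<le> l \<and> k + l = n + 1. \<Sum>\<sigma>\<in>Sh k n.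
             scale ((- 1) ^ (k * (l - 1)) * chi \<sigma> ds)
               (mu l (mu k (take k (permute_list \<sigma> xs)) # drop k (permute_list \<sigma> xs)))) = 0"
proof -
  define s where "s = [1..<Suc n]"
  define dg where "dg = (\<lambda>i. ds ! (i - 1))"
  define a where "a = (\<lambda>i. xs ! (i - 1))"
  let ?S = "{1..n}" and ?p = "\<lambda>i. dg i - 1"
  have len: "length ds = n" using assms by (auto simp: homogeneous_list_def dest: list_all2_lengthD)
  have s: "sorted_wrt (<) s" "length s = n" "set s = ?S" "distinct s"
    by (simp_all add: s_def atLeastLessThanSuc_atLeastAtMost del: upt_Suc)
  have ds: "ds = map dg s" and xs: "xs = map a s"
    using map_nth_pred[of ds] map_nth_pred[of xs] len assms(1) by (simp_all add: s_def dg_def a_def)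
  have aL: "a i \<in> L (dg i)" if "i \<in> ?S" for i
    using homogeneous_listD[OF assms(2)] that assms(1) by (simp add: a_def dg_def)
  have da: "d (a i) = 0" if "i \<in> ?S" for i
  proof -
    have "a i \<in> set xs" using that s(3) unfolding xs by simp
    then show ?thesis using assms(3) ker_iff by blast
  qed
  let ?F = "\<lambda>k l ws. sg (int (k * (l - 1)) + word_exponent dg ws)
      (mu l (mu k (map a (take k ws)) # map a (drop k ws)))"
  have "(\<Sum>(k, l) | 1 \<le> k \<and> 1 \<le> l \<and> k + l = n + 1. \<Sum>\<sigma>\<in>Sh k n.
             scale ((- 1) ^ (k * (l - 1)) * chi \<sigma> ds)
               (mu l (mu k (take k (permute_list \<sigma> xs)) # drop k (permute_list \<sigma> xs))))
      = (\<Sum>(k, l) | 1 \<le> k \<and> 1 \<le> l \<and> k + l = n + 1. \<Sum>\<sigma>\<in>Sh k n. ?F k l (permute_list \<sigma> s))"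
  proof (intro sum.cong refl; clarify; intro sum.cong refl)
    fix k l \<sigma> assume "\<sigma> \<in> Sh k n"
    then have \<sigma>: "\<sigma> permutes {..<length s}" by (simp add: Sh_def s(2))
    have "permute_list \<sigma> xs = map a (permute_list \<sigma> s)" unfolding xs by (rule permute_list_map[OF \<sigma>])
    moreover have "chi \<sigma> ds = (ksgn (word_exponent dg (permute_list \<sigma> s)) :: 'k)"
      unfolding ds by (rule chi_word_exponent[OF s(1) \<sigma>])
    ultimately show "scale ((- 1) ^ (k * (l - 1)) * chi \<sigma> ds)
        (mu l (mu k (take k (permute_list \<sigma> xs)) # drop k (permute_list \<sigma> xs))) = ?F k l (permute_list \<sigma> s)"
      by (simp add: minus_one_power_ksgn take_map drop_map scale_ksgn flip: ksgn_add)
  qed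
  also have "\<dots> = (\<Sum>A\<in>Pow ?S - {{}}. ?F (card A) (n + 1 - card A)
      (sorted_list_of_set A @ sorted_list_of_set (?S - A)))"
    using sum_shuffles[OF s(1,2), of ?F] s(3) by simp
  also have "\<dots> = (\<Sum>A\<in>Pow ?S - {{}}. sg (decalage dg ?S) (sg (koszul ?p A (?S - A))
           (Mu (?p(0 := sum ?p A + 1)) (a(0 := Mu ?p a A)) (insert 0 (?S - A)))))"
  proof (intro sum.cong refl)
    fix A assume A: "A \<in> Pow ?S - {{}}"
    then have fA: "finite A" using finite_subset by auto
    have card: "card (?S - A) = n - card A" "card A \<le> n"
      using A fA card_mono[of ?S A] by (auto simp: card_Diff_subset)
    have l: "n + 1 - card A = Suc (card (?S - A))" using card by simp
    let ?u = "sorted_list_of_set A" and ?v = "sorted_list_of_set (?S - A)"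
    have "distinct (?u @ ?v)" using fA by auto
    then have "word_exponent dg (?u @ ?v) = crossing (\<lambda>i j. 1 + dg i * dg j) A (?S - A)"
      using fA word_exponent_append[of ?u ?v dg] by (simp add: word_exponent_sorted)
    then show "?F (card A) (n + 1 - card A) (?u @ ?v) = sg (decalage dg ?S) (sg (koszul ?p A (?S - A))
           (Mu (?p(0 := sum ?p A + 1)) (a(0 := Mu ?p a A)) (insert 0 (?S - A))))"
      using mu_composite[of ?S a dg A] aL A fA unfolding l by simp
  qed
  also have "\<dots> = sg (decalage dg ?S) (\<Sum>A\<in>Pow ?S - {{}}. sg (koszul ?p A (?S - A))
           (Mu (?p(0 := sum ?p A + 1)) (a(0 := Mu ?p a A)) (insert 0 (?S - A))))"
    by (simp only: sg_sum)
  also have "(\<Sum>A\<in>Pow ?S - {{}}. sg (koszul ?p A (?S - A))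
           (Mu (?p(0 := sum ?p A + 1)) (a(0 := Mu ?p a A)) (insert 0 (?S - A))))
      = (\<Sum>A\<in>Pow ?S. sg (koszul ?p A (?S - A))
           (Mu (?p(0 := sum ?p A + 1)) (a(0 := Mu ?p a A)) (insert 0 (?S - A))))"
  proof (rule sum.mono_neutral_left)
    \<comment> \<open>the summand for the empty set inserts \<open>M {} = 0\<close>\<close>
    have "Mu q (a(0 := 0)) (insert 0 ?S) = 0" for q
      by (rule Mu_eq_0[of _ 0]) auto
    then show "\<forall>A\<in>Pow ?S - (Pow ?S - {{}}). sg (koszul ?p A (?S - A))
           (Mu (?p(0 := sum ?p A + 1)) (a(0 := Mu ?p a A)) (insert 0 (?S - A))) = 0"
      by (auto simp: Mu_small)
  qed auto
  also have "\<dots> = 0" by (rule Mu_identity) (use aL da in auto)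
  finally show ?thesis by simp
qed

lemma L_infinity: "L_infinity_algebra scale H (\<lambda>i. H \<inter> L i) mu"
proof (intro L_infinity_algebra.intro graded_module_H L_infinity_algebra_axioms.intro)
  have homL: "homogeneous_list L ds xs" "set xs \<subseteq> H" if "homogeneous_list (\<lambda>i. H \<inter> L i) ds xs" for ds xs
    using that by (auto simp: homogeneous_list_def list_all2_conv_all_nth in_set_conv_nth)
  fix n :: nat and ds xs and \<sigma> :: "nat \<Rightarrow> nat"
  show "mu n xs \<in> H" by (rule mu_in_H)
  show "multilinear_on scale H n (mu n)"
    unfolding multilinear_on_def using module_hom.add[OF mu_linear] module_hom.scale[OF mu_linear] by blast
  assume n: "1 \<le> n" "length xs = n" and hom: "homogeneous_list (\<lambda>i. H \<inter> L i) ds xs"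
  show "mu n xs \<in> H \<inter> L (sum_list ds + 2 - int n)"
    using mu_in_H mu_degree[OF n homL(1)[OF hom]] by blast
  show "(\<Sum>(k, l) | 1 \<le> k \<and> 1 \<le> l \<and> k + l = n + 1. \<Sum>\<sigma>\<in>Sh k n.
             scale ((- 1) ^ (k * (l - 1)) * chi \<sigma> ds)
               (mu l (mu k (take k (permute_list \<sigma> xs)) # drop k (permute_list \<sigma> xs)))) = 0"
    by (rule mu_identity[OF n(2) homL[OF hom]])
  assume "\<sigma> permutes {..<n}"
  then show "mu n (permute_list \<sigma> xs) = scale (chi \<sigma> ds) (mu n xs)"
    by (rule mu_antisymmetric[OF n(2) homL(1)[OF hom]])
qed

text \<open>
  The two orders of the arguments contribute equally, which cancels the factor \<open>1/2\<close>, and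
  \<open>\<eta>d[x, y] = 0\<close> because \<open>x\<close> and \<open>y\<close> are cycles.
\<close>

lemma mu_2_homogeneous:
  assumes x: "x \<in> H" "x \<in> L i" and y: "y \<in> H" "y \<in> L j"
  shows "mu 2 [x, y] = bracket x y - d (\<eta> (bracket x y))"
proof -
  let ?p = "\<lambda>_::nat. j - 1" and ?a = "\<lambda>_::nat. y"
  have Pow: "Pow {Suc 0} = {{}, {Suc 0}}" by auto
  have "pointed_convolve ?p ?a (i - 1) x {1} = sg (i - 1) (bracket x y)"
    by (simp add: pointed_convolve_def Pow bracket_0)
  then have "Mu (?p(0 := i - 1)) (?a(0 := x)) (insert 0 {1}) = - proj (sg (i - 1) (bracket x y))"
    using Mu_insert_0[of "{1}" ?a ?p x "i - 1"] x y by simp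
  moreover have "decalage (\<lambda>_. j) {1} = 0" by (simp add: decalage_def)
  ultimately have "mu 2 [x, y] = sg i (- sg (i - 1) (proj (bracket x y)))"
    using mu_insert_Mu[of "{1}" ?a "\<lambda>_. j" x i] x y
    by (simp add: hom_sg[OF proj_linear] numeral_2_eq_2)
  also have "\<dots> = proj (bracket x y)" by (simp add: sg_def)
  also have "d (bracket x y) = 0"
    using leibniz[OF x(2) y(2)] x(1) y(1) ker_iff by (simp add: bracket_0)
  then have "proj (bracket x y) = bracket x y - d (\<eta> (bracket x y))"
    by (simp add: proj_def comm_op_def \<eta>_simps)
  finally show ?thesis .
qed

lemma mu_2:
  assumes a: "a \<in> H" and b: "b \<in> H"
  shows "mu 2 [a, b] = bracket a b - d (\<eta> (bracket a b))"
proof -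
  let ?f = "\<lambda>x y. bracket x y - d (\<eta> (bracket x y))"
  have f: "module_hom scale scale (\<lambda>x. ?f x y)" "module_hom scale scale (?f x)" for x y
    by (intro linearI; simp add: bracket_add bracket_scale d_simps \<eta>_simps scale_right_diff_distrib)+
  have m: "module_hom scale scale (\<lambda>x. mu 2 [x, y])" "module_hom scale scale (\<lambda>y. mu 2 [x, y])" for x y
    using mu_linear[of "[x, y]" 2 0] mu_linear[of "[x, y]" 2 1] by simp_all
  have "mu 2 [a, b] = mu 2 [\<Sum>i | hcomp L a i \<noteq> 0. hcomp L a i, \<Sum>j | hcomp L b j \<noteq> 0. hcomp L b j]"
    by (simp only: sum_hcomp)
  also have "\<dots> = (\<Sum>i | hcomp L a i \<noteq> 0. \<Sum>j | hcomp L b j \<noteq> 0. mu 2 [hcomp L a i, hcomp L b j])"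
    by (simp only: module_hom.sum[OF m(1)]) (simp only: module_hom.sum[OF m(2)])
  also have "\<dots> = (\<Sum>i | hcomp L a i \<noteq> 0. \<Sum>j | hcomp L b j \<noteq> 0. ?f (hcomp L a i) (hcomp L b j))"
    using mu_2_homogeneous hcomp_H[OF a] hcomp_H[OF b] hcomp_degree by (intro sum.cong refl) blast
  also have "\<dots> = ?f (\<Sum>i | hcomp L a i \<noteq> 0. hcomp L a i) (\<Sum>j | hcomp L b j \<noteq> 0. hcomp L b j)"
    by (simp only: module_hom.sum[OF f(1)]) (simp only: module_hom.sum[OF f(2)])
  finally show ?thesis by (simp only: sum_hcomp)
qed

end

theorem theorem4p4:
  fixes scale :: "'k::comm_ring_1 \<Rightarrow> 'a::ab_group_add \<Rightarrow> 'a"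
    and \<iota> :: "rat \<Rightarrow> 'k"
    and L :: "int \<Rightarrow> 'a set"
    and d \<eta> :: "'a \<Rightarrow> 'a"
    and bracket :: "'a \<Rightarrow> 'a \<Rightarrow> 'a"
  assumes "rat_embedding \<iota>"
    and "dg_lie_algebra scale L d bracket"
    and "module_hom scale scale \<eta>"
    and "\<And>i x. x \<in> L i \<Longrightarrow> \<eta> x \<in> L (i - 1)"
    and "\<And>x. d (\<eta> (d x)) = d x"
    and "\<And>x. \<eta> (\<eta> x) = 0"
    and "\<And>x. \<eta> (d (\<eta> x)) = \<eta> x"
  shows "L_infinity_algebra scale (ker_comm_op d \<eta>) (\<lambda>i. ker_comm_op d \<eta> \<inter> L i)
           (transferred_mu scale \<iota> L d bracket \<eta>)
       \<and> (\<forall>a\<in>ker_comm_op d \<eta>. \<forall>b\<in>ker_comm_op d \<eta>.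
            transferred_mu scale \<iota> L d bracket \<eta> 2 [a, b] = bracket a b - d (\<eta> (bracket a b)))"
proof -
  interpret homotopy_transfer scale L d bracket \<iota> \<eta>
    using assms by (intro homotopy_transfer.intro homotopy_transfer_axioms.intro)
  show ?thesis using L_infinity mu_2 by blast
qed

end
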